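(* Let $\{\mathcal{X},p(y|x),\mathcal{Y}\}$ be a discrete memoryless channel whose input alphabet is the $M$-ASK alphabet $\mathcal{X}=\{-M+1,-M+3,\dots,M-1\}$ with $M=2^{m+1}$, $m\ge 1$. Let $\mathcal{S}=\{-1,+1\}$ and $\mathcal{A}=\{1,3,\dots,M-1\}$. For a probability distribution $p(a)$ on $\mathcal{A}$, let $A\sim p(a)$, let $S$ be uniform on $\mathcal{S}$ and independent of $A$, let $X=SA$, and let $Y$ be the channel output when $X$ is the channel input. Then the rate $$R_{\mathrm{SMD}}^{\gamma=0}=\max_{p(a):\,H(A)\le I(SA;Y)} H(A)$$ is achievable with amplitude shaping and basic sign-coding, using symbol-metric decoding (SMD).
   Context: Conventions. Logarithms are base 2 and entropies are in bits. The output alphabet $\mathcal{Y}$ is discrete and all entropies involved are finite (automatic if $\mathcal{Y}$ is finite). The channel is memoryless: $p(\underline{y}|\underline{x})=\prod_{i=1}^n p(y_i|x_i)$. Underlined letters denote length-$n$ sequences, and $\otimes$ is element-wise multiplication. $I(SA;Y)$ is the mutual information between the pair $(S,A)$ (equivalently $X$) and $Y$. Typical sets. Let $(X_1,\dots,X_k)$ be discrete random variables with joint distribution $p(x_1,\dots,x_k)$, and let $\varepsilon>0$. The weakly jointly typical set $\mathcal{A}^n_\varepsilon(X_1\cdots X_k)$ is the set of tuples $(\underline{x}_1,\dots,\underline{x}_k)$ of length-$n$ sequences such that, for every nonempty $J\subseteq\{1,\dots,k\}$, $\left|-\frac1n\log p(\underline{x}_J)-H(X_J)\right|\le\varepsilon$,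 where $\underline{x}_J=(\underline{x}_j)_{j\in J}$, $X_J=(X_j)_{j\in J}$, and $p(\underline{x}_J)$ is the $n$-fold product of the marginal distribution of $X_J$. $\mathcal{B}$-typical set. For $p(u,v)=p(u)p(v|u)$, define $$\mathcal{B}^n_{V,\varepsilon}(U)=\Big\{\underline{u}:\ \underline{u}\in\mathcal{A}^n_\varepsilon(U)\ \text{and}\ \Pr\{(\underline{u},\underline{V})\in\mathcal{A}^n_\varepsilon(UV)\mid \underline{U}=\underline{u}\}\ge 1-\varepsilon\Big\},$$ where, given $\underline{U}=\underline{u}$, $\underline{V}$ has distribution $\prod_i p(v_i|u_i)$. $U$ and $V$ may be composite; for instance $\mathcal{B}^n_{SY,\varepsilon}(A)$ is the case $U=A$, $V=(S,Y)$. Basic sign-coding encoder with SMD. Its parameters are a distribution $p(a)$ on $\mathcal{A}$ (which determines the joint distribution of $(A,S,Y)$ with $S$ uniform and independent of $A$), a number $\varepsilon>0$, and a blocklength $n$. The message $m_a$ is uniform on $\{1,\dots,M_a\}$; there is no additional message, i.e. $M_s=1$. A shaping layer maps messages one-to-one to amplitude sequences $\underline{a}(m_a)\in\mathcal{B}^n_{SY,\varepsilon}(A)\subseteq\mathcal{A}^n$. A coding layer assigns to each $m_a$ a sign sequence $\underline{s}(m_a)\in\mathcal{S}^n$ (a function of $\underline{a}(m_a)$). The transmitted sequence is $\underline{x}(m_a)=\underline{a}(m_a)\otimes\underline{s}(m_a)$. SMD. Upon receiving $\underline{y}$, the decoder outputs the unique index $\hat m_a$ such that $(\underline{a}(\hat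 m_a),\underline{s}(\hat m_a),\underline{y})\in\mathcal{A}^n_\varepsilon(ASY)$; if there is no such unique index, an error is declared. The error probability is $P_e=\Pr\{\hat m_a\ne m_a\}$. Achievability. A rate $R$ is achievable (with basic sign-coding, using SMD) if for every $\delta>0$ and all $n$ large enough there exists a basic sign-coding encoder of blocklength $n$ (that is, a distribution $p(a)$ on $\mathcal{A}$, a number $\varepsilon>0$, an integer $M_a\ge 1$ with $M_s=1$, a one-to-one map $m_a\mapsto\underline{a}(m_a)\in\mathcal{B}^n_{SY,\varepsilon}(A)$ and sign sequences $\underline{s}(m_a)\in\mathcal{S}^n$, $m_a=1,\dots,M_a$) such that, when $\underline{x}(m_a)=\underline{a}(m_a)\otimes\underline{s}(m_a)$ is transmitted and the decoder is the SMD decoder that outputs the unique $\hat m_a$ with $(\underline{a}(\hat m_a),\underline{s}(\hat m_a),\underline{y})\in\mathcal{A}^n_\varepsilon(ASY)$ for the same $p(a)$ and $\varepsilon$, one has $\frac1n\log_2(M_aM_s)\ge R-\delta$ and $P_e\le\delta$. *)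

theory Defs
  imports "HOL-Probability.Probability"
begin

section \<open>Entropy and mutual information of discrete distributions, in bits\<close>

definition pmf_entropy :: "'a pmf \<Rightarrow> real" where
  "pmf_entropy p = prob_space.entropy (measure_pmf p) 2 (count_space UNIV) (\<lambda>x. x)"

definition finite_entropy_pmf :: "'a pmf \<Rightarrow> bool" where
  "finite_entropy_pmf p \<longleftrightarrow>
     information_space.finite_entropy (measure_pmf p) 2 (count_space UNIV) (\<lambda>x. x) (pmf p)"

lemma pmf_entropy_eq:
  fixes p :: "'a::countable pmf"
  shows "pmf_entropy p = - measure_pmf.expectation p (\<lambda>x. log 2 (pmf p x))"
proof -
  interpret information_space "measure_pmf p" 2
    by unfold_locales auto
  interpret C: sigma_finite_measure "count_space (UNIV :: 'a set)"
    by (rule sigma_finite_measure_count_space)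
  have dens: "density (count_space UNIV) (\<lambda>x. ennreal (pmf p x)) = measure_pmf p"
    by (rule measure_pmf_eq_density[symmetric])
  have "measure_pmf.expectation p (\<lambda>x. log 2 (pmf p x))
        = (\<integral>x. pmf p x * log 2 (pmf p x) \<partial>count_space UNIV)"
    using integral_density[of "\<lambda>x. log 2 (pmf p x)" "count_space UNIV" "pmf p"]
    by (simp add: dens)
  also have "\<dots> = KL_divergence 2 (count_space UNIV)
        (density (count_space UNIV) (\<lambda>x. ennreal (pmf p x)))"
    by (rule C.KL_density[symmetric]) auto
  finally have "KL_divergence 2 (count_space UNIV) (measure_pmf p) =
        measure_pmf.expectation p (\<lambda>x. log 2 (pmf p x))"
    by (simp add: dens)
  moreover have "distr (measure_pmf p) (count_space UNIV) (\<lambda>x. x) = measure_pmf p"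
    using map_pmf_rep_eq[of "\<lambda>x. x" p] by simp
  ultimately show ?thesis
    by (simp add: pmf_entropy_def prob_space.entropy_def[OF prob_space_measure_pmf])
qed

lemma finite_entropy_pmf_iff:
  "finite_entropy_pmf p \<longleftrightarrow> integrable (measure_pmf p) (\<lambda>x. log 2 (pmf p x))"
proof -
  interpret information_space "measure_pmf p" 2
    by unfold_locales auto
  have dens: "density (count_space UNIV) (\<lambda>x. ennreal (pmf p x)) = measure_pmf p"
    by (rule measure_pmf_eq_density[symmetric])
  have "distributed (measure_pmf p) (count_space UNIV) (\<lambda>x. x) (\<lambda>x. ennreal (pmf p x))"
    using map_pmf_rep_eq[of "\<lambda>x. x" p] by (simp add: distributed_def dens)
  moreover have "integrable (measure_pmf p) (\<lambda>x. log 2 (pmf p x)) \<longleftrightarrow>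
      integrable (count_space UNIV) (\<lambda>x. pmf p x * log 2 (pmf p x))"
    using integrable_density[of "\<lambda>x. log 2 (pmf p x)" "count_space UNIV" "pmf p"]
    by (simp add: dens)
  ultimately show ?thesis
    by (simp add: finite_entropy_pmf_def information_space.finite_entropy_def[OF information_space_axioms])
qed


section \<open>Alphabets and the joint distribution of amplitude, sign and output\<close>

definition ask_alphabet :: "nat \<Rightarrow> int set" where
  "ask_alphabet M = {2 * int k - int M + 1 | k. k < M}"

definition amplitudes :: "nat \<Rightarrow> int set" where
  "amplitudes M = {2 * int k + 1 | k. k < M div 2}"

definition signs :: "int set" where
  "signs = {-1, 1}"

text \<open>
  A channel is a kernel \<^term>\<open>W :: int \<Rightarrow> 'y pmf\<close> with \<open>p(y|x) = pmf (W x) y\<close>.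
  By the following fact only its values on the ASK alphabet are ever used.
\<close>

lemma ask_alphabet_eq_sign_times_amplitude:
  assumes "even M"
  shows "ask_alphabet M = (\<lambda>(s, a). s * a) ` (signs \<times> amplitudes M)"
proof -
  from assms obtain h where M: "M = 2 * h" by blast
  show ?thesis
  proof (intro equalityI subsetI)
    fix x assume "x \<in> ask_alphabet M"
    then obtain k where k: "k < 2 * h" "x = 2 * int k - 2 * int h + 1"
      by (auto simp: ask_alphabet_def M)
    show "x \<in> (\<lambda>(s, a). s * a) ` (signs \<times> amplitudes M)"
    proof (cases "h \<le> k")
      case True
      have "x \<in> amplitudes M"
        unfolding amplitudes_def using k True by (auto intro!: exI[of _ "k - h"] simp: M)
      then show ?thesis
        by (intro image_eqI[of _ _ "(1, x)"]) (auto simp: signs_def)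
    next
      case False
      have "- x \<in> amplitudes M"
        unfolding amplitudes_def using k False
        by (auto intro!: exI[of _ "h - 1 - k"] simp: M)
      then show ?thesis
        by (intro image_eqI[of _ _ "(-1, -x)"]) (auto simp: signs_def)
    qed
  next
    fix x assume "x \<in> (\<lambda>(s, a). s * a) ` (signs \<times> amplitudes M)"
    then obtain s k where *: "s \<in> signs" "k < h" "x = s * (2 * int k + 1)"
      by (auto simp: amplitudes_def M)
    then consider "x = 2 * int k + 1" | "x = - (2 * int k + 1)"
      by (auto simp: signs_def)
    then show "x \<in> ask_alphabet M"
    proof cases
      case 1
      then show ?thesis using *
        by (auto simp: ask_alphabet_def M intro!: exI[of _ "h + k"])
    next
      case 2
      then show ?thesis using *
        by (auto simp: ask_alphabet_def M intro!: exI[of _ "h - 1 - k"])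
    qed
  qed
qed

definition sign_output :: "(int \<Rightarrow> 'y pmf) \<Rightarrow> int \<Rightarrow> (int \<times> 'y) pmf" where
  "sign_output W a =
     do { s \<leftarrow> pmf_of_set signs; y \<leftarrow> W (s * a); return_pmf (s, y) }"

definition joint_pmf :: "int pmf \<Rightarrow> (int \<Rightarrow> 'y pmf) \<Rightarrow> (int \<times> int \<times> 'y) pmf" where
  "joint_pmf p W =
     do { a \<leftarrow> p; (s, y) \<leftarrow> sign_output W a; return_pmf (a, s, y) }"

definition mutual_info_SA_Y :: "int pmf \<Rightarrow> (int \<Rightarrow> 'y pmf) \<Rightarrow> real" where
  "mutual_info_SA_Y p W =
     prob_space.mutual_information (measure_pmf (joint_pmf p W)) 2
       (count_space UNIV) (count_space UNIV) (\<lambda>(a, s, y). (s, a)) (\<lambda>(a, s, y). y)"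

lemma mutual_info_SA_Y_eq:
  fixes W :: "int \<Rightarrow> 'y::countable pmf" and p :: "int pmf"
  defines "P \<equiv> joint_pmf p W"
  defines "Q \<equiv> map_pmf (\<lambda>(a, s, y). ((s, a), y)) P"
  shows "mutual_info_SA_Y p W =
    (\<integral>z. pmf Q z * log 2 (pmf Q z / (pmf (map_pmf fst Q) (fst z) * pmf (map_pmf snd Q) (snd z)))
      \<partial>count_space UNIV)"
proof -
  interpret information_space "measure_pmf P" 2
    by unfold_locales auto
  have d: "distributed (measure_pmf P) (count_space UNIV) f (\<lambda>x. ennreal (pmf (map_pmf f P) x))"
    for f :: "_ \<Rightarrow> 'b"
    by (simp add: distributed_def measure_pmf_eq_density[symmetric] map_pmf_rep_eq[symmetric])
  have pm: "count_space UNIV \<Otimes>\<^sub>M count_space UNIV = (count_space UNIV :: ((int \<times> int) \<times> 'y) measure)"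
    by (simp add: pair_measure_countable)
  have eq: "(\<lambda>x. ((\<lambda>(a, s, y). (s, a)) x, (\<lambda>(a, s, y). y) x)) = (\<lambda>(a::int, s::int, y::'y). ((s, a), y))"
    by auto
  have marg: "map_pmf fst Q = map_pmf (\<lambda>(a, s, y). (s, a)) P" "map_pmf snd Q = map_pmf (\<lambda>(a, s, y). y) P"
    by (auto simp: Q_def map_pmf_comp intro!: map_pmf_cong)
  show ?thesis
    unfolding mutual_info_SA_Y_def P_def[symmetric] marg
    by (subst mutual_information_distr[OF _ _ d _ d, where Pxy = "pmf Q"])
       (auto simp: pm eq Q_def sigma_finite_measure_count_space intro!: d)
qed


section \<open>Typical sets\<close>

text \<open>
  A sequence of length \<open>n\<close> is a function on \<^typ>\<open>nat\<close> of which only the values at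
  indices below \<open>n\<close> matter; codewords and channel outputs are \<^const>\<open>undefined\<close> from \<open>n\<close> on,
  so that distinct functions are distinct sequences. Requiring the letters to have positive
  probability excludes sequences of probability 0, for which \<open>- log 0 = \<infinity>\<close> in the usual
  convention whereas \<open>log 2 0 = 0\<close> here.
\<close>

definition typical :: "nat \<Rightarrow> real \<Rightarrow> 'a pmf \<Rightarrow> (nat \<Rightarrow> 'a) \<Rightarrow> bool" where
  "typical n \<epsilon> p x \<longleftrightarrow>
     (\<forall>i<n. pmf p (x i) > 0) \<and>
     \<bar>- (1 / real n) * log 2 (\<Prod>i<n. pmf p (x i)) - pmf_entropy p\<bar> \<le> \<epsilon>"

text \<open>Weak joint typicality of three variables: one condition per nonempty subset of them.\<close>

definition jointly_typical3 ::
    "nat \<Rightarrow> real \<Rightarrow> ('a \<times> 'b \<times> 'c) pmf \<Rightarrow> (nat \<Rightarrow> 'a) \<Rightarrow> (nat \<Rightarrow> 'b) \<Rightarrow> (nat \<Rightarrow> 'c) \<Rightarrow> bool" where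
  "jointly_typical3 n \<epsilon> P a s y \<longleftrightarrow>
     typical n \<epsilon> (map_pmf (\<lambda>(a, s, y). a) P) a \<and>
     typical n \<epsilon> (map_pmf (\<lambda>(a, s, y). s) P) s \<and>
     typical n \<epsilon> (map_pmf (\<lambda>(a, s, y). y) P) y \<and>
     typical n \<epsilon> (map_pmf (\<lambda>(a, s, y). (a, s)) P) (\<lambda>i. (a i, s i)) \<and>
     typical n \<epsilon> (map_pmf (\<lambda>(a, s, y). (a, y)) P) (\<lambda>i. (a i, y i)) \<and>
     typical n \<epsilon> (map_pmf (\<lambda>(a, s, y). (s, y)) P) (\<lambda>i. (s i, y i)) \<and>
     typical n \<epsilon> P (\<lambda>i. (a i, s i, y i))"

text \<open>The set \<open>B\<^bsub>SY,\<epsilon>\<^esub>(A)\<close> of amplitude sequences of length \<open>n\<close>.\<close>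

definition B_typical ::
    "nat \<Rightarrow> nat \<Rightarrow> real \<Rightarrow> int pmf \<Rightarrow> (int \<Rightarrow> 'y pmf) \<Rightarrow> (nat \<Rightarrow> int) set" where
  "B_typical M n \<epsilon> p W =
     {a \<in> {..<n} \<rightarrow>\<^sub>E amplitudes M.
        typical n \<epsilon> p a \<and>
        measure_pmf.prob (Pi_pmf {..<n} undefined (\<lambda>i. sign_output W (a i)))
          {v. jointly_typical3 n \<epsilon> (joint_pmf p W) a (\<lambda>i. fst (v i)) (\<lambda>i. snd (v i))}
        \<ge> 1 - \<epsilon>}"


section \<open>Basic sign-coding with symbol-metric decoding\<close>

definition memoryless_output :: "nat \<Rightarrow> (int \<Rightarrow> 'y pmf) \<Rightarrow> (nat \<Rightarrow> int) \<Rightarrow> (nat \<Rightarrow> 'y) pmf" where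
  "memoryless_output n W x = Pi_pmf {..<n} undefined (\<lambda>i. W (x i))"

text \<open>There is no additional message, so the only messages are \<open>1, \<dots>, Ma\<close>.\<close>

definition basic_sign_encoder ::
    "nat \<Rightarrow> (int \<Rightarrow> 'y pmf) \<Rightarrow> nat \<Rightarrow> int pmf \<Rightarrow> real \<Rightarrow> nat \<Rightarrow>
     (nat \<Rightarrow> nat \<Rightarrow> int) \<Rightarrow> (nat \<Rightarrow> nat \<Rightarrow> int) \<Rightarrow> bool" where
  "basic_sign_encoder M W n p \<epsilon> Ma a s \<longleftrightarrow>
     set_pmf p \<subseteq> amplitudes M \<and> \<epsilon> > 0 \<and> Ma \<ge> 1 \<and>
     inj_on a {1..Ma} \<and> a \<in> {1..Ma} \<rightarrow> B_typical M n \<epsilon> p W \<and>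
     s \<in> {1..Ma} \<rightarrow> ({..<n} \<rightarrow>\<^sub>E signs)"

definition smd_decode ::
    "(int \<Rightarrow> 'y pmf) \<Rightarrow> nat \<Rightarrow> int pmf \<Rightarrow> real \<Rightarrow> nat \<Rightarrow>
     (nat \<Rightarrow> nat \<Rightarrow> int) \<Rightarrow> (nat \<Rightarrow> nat \<Rightarrow> int) \<Rightarrow> (nat \<Rightarrow> 'y) \<Rightarrow> nat option" where
  "smd_decode W n p \<epsilon> Ma a s y =
     (let ok = (\<lambda>k. k \<in> {1..Ma} \<and> jointly_typical3 n \<epsilon> (joint_pmf p W) (a k) (s k) y)
      in if \<exists>!k. ok k then Some (THE k. ok k) else None)"

definition smd_error_prob ::
    "(int \<Rightarrow> 'y pmf) \<Rightarrow> nat \<Rightarrow> int pmf \<Rightarrow> real \<Rightarrow> nat \<Rightarrow>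
     (nat \<Rightarrow> nat \<Rightarrow> int) \<Rightarrow> (nat \<Rightarrow> nat \<Rightarrow> int) \<Rightarrow> real" where
  "smd_error_prob W n p \<epsilon> Ma a s =
     measure_pmf.prob
       (do { k \<leftarrow> pmf_of_set {1..Ma};
             y \<leftarrow> memoryless_output n W (\<lambda>i. a k i * s k i);
             return_pmf (k, smd_decode W n p \<epsilon> Ma a s y) })
       {(k, k'). k' \<noteq> Some k}"

definition achievable_smd :: "nat \<Rightarrow> (int \<Rightarrow> 'y pmf) \<Rightarrow> real \<Rightarrow> bool" where
  "achievable_smd M W R \<longleftrightarrow>
     (\<forall>\<delta>>0. \<forall>\<^sub>F n in sequentially. \<exists>p \<epsilon> Ma a s.
        basic_sign_encoder M W n p \<epsilon> Ma a s \<and>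
        (1 / real n) * log 2 (real Ma) \<ge> R - \<delta> \<and>
        smd_error_prob W n p \<epsilon> Ma a s \<le> \<delta>)"

end

theory Submission
  imports Defs "HOL-Real_Asymp.Real_Asymp"
begin

text \<open>
  Achievability: assign independent uniform sign sequences to all \<open>N \<ge> 2\<^bsup>n(H(A) - \<epsilon>)\<^esup> / 2\<close> sequences of
  \<open>B\<^bsub>SY,\<epsilon>\<^esub>(A)\<close> and keep only \<open>K \<approx> 2\<^bsup>n(H(A) - \<delta>)\<^esup>\<close> of them. By definition of \<open>B\<close>, the transmitted
  pair is jointly typical with the output except with probability \<open>\<epsilon>\<close> on average over the signs.
  The uniform distribution on \<open>B\<close> is dominated by \<open>2 \<sqdot> 2\<^bsup>2n\<epsilon>\<^esup>\<close> times the i.i.d. one, so another codeword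
  is jointly typical with the output with probability at most about \<open>2\<^bsup>-n(I(SA;Y) - 7\<epsilon>)\<^esup>\<close>; multiplied by \<open>K\<close>
  this vanishes even if \<open>H(A) = I(SA;Y)\<close>. Thinning out \<open>B\<close> is what makes this boundary case work:
  with all of \<open>B\<close> as codebook one would need \<open>H(A) < I(SA;Y)\<close>.

  The maximum exists because \<open>H(A)\<close> and \<open>I(SA;Y)\<close> are continuous in \<open>p(a)\<close>; for \<open>H(Y)\<close> with \<open>Y\<close> countably
  infinite this is dominated convergence, as every output distribution is at most \<open>|A|\<close> times
  the one belonging to the uniform \<open>p(a)\<close>.
\<close>

section \<open>Typicality\<close>

lemma tendsto_expectation_truncated:
  fixes g :: "'a \<Rightarrow> real"
  assumes "integrable (measure_pmf P) g"
  shows "(\<lambda>c. measure_pmf.expectation P (\<lambda>x. if \<bar>g x\<bar> \<le> real c then 0 else \<bar>g x\<bar>)) \<longlonglongrightarrow> 0"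
proof -
  have "(\<lambda>c. measure_pmf.expectation P (\<lambda>x. if \<bar>g x\<bar> \<le> real c then 0 else \<bar>g x\<bar>))
      \<longlonglongrightarrow> measure_pmf.expectation P (\<lambda>x. 0)"
  proof (rule integral_dominated_convergence[where w="\<lambda>x. \<bar>g x\<bar>"])
    show "AE x in measure_pmf P. (\<lambda>c. if \<bar>g x\<bar> \<le> real c then 0 else \<bar>g x\<bar>) \<longlonglongrightarrow> 0"
    proof (rule AE_I2, rule tendsto_eventually)
      fix x
      obtain k where k: "\<bar>g x\<bar> \<le> real k" using real_arch_simple by blast
      show "\<forall>\<^sub>F c in sequentially. (if \<bar>g x\<bar> \<le> real c then 0 else \<bar>g x\<bar>) = 0"
        using eventually_ge_at_top[of k] by eventually_elim (use k in auto)
    qed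
  qed (use assms in auto)
  then show ?thesis by simp
qed

text \<open>Coordinates of a product pmf are independent, so Hoeffding's inequality applies with
  every letter in [-c, c]: a deviation n \<epsilon> of the sum gives the exponent 2 (n \<epsilon>)^2
  / (n (2 c)^2).\<close>

lemma Hoeffding_Pi_pmf:
  fixes g :: "'a \<Rightarrow> real" and n :: nat
  assumes g: "\<And>x. \<bar>g x\<bar> \<le> c" and "c > 0" "\<epsilon> > 0" "n > 0"
  shows "measure_pmf.prob (Pi_pmf ({..<n} :: nat set) d (\<lambda>_. P))
      {x. \<bar>(\<Sum>i<n. g (x i)) / n - measure_pmf.expectation P g\<bar> \<ge> \<epsilon>} \<le> 2 * exp (- (\<epsilon>\<^sup>2 / (2 * c\<^sup>2)) * n)"
proof -
  let ?Q = "Pi_pmf ({..<n} :: nat set) d (\<lambda>_. P)"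
  have ex: "measure_pmf.expectation ?Q (\<lambda>x. g (x i)) = measure_pmf.expectation P g" if "i < n" for i
  proof -
    have "measure_pmf.expectation (map_pmf (\<lambda>f. f i) ?Q) g = measure_pmf.expectation P g"
      using that by (subst Pi_pmf_component) auto
    then show ?thesis by simp
  qed
  interpret Hoeffding_ineq "measure_pmf ?Q" "{..<n}" "\<lambda>i x. g (x i)" "\<lambda>_. -c" "\<lambda>_. c"
     "real n * measure_pmf.expectation P g"
  proof unfold_locales
    show "prob_space.indep_vars (measure_pmf ?Q) (\<lambda>_. borel) (\<lambda>i x. g (x i)) {..<n}"
      by (rule prob_space.indep_vars_compose2[OF _ indep_vars_Pi_pmf]) (auto simp: measure_pmf.prob_space_axioms)
    show "AE x in measure_pmf ?Q. g (x i) \<in> {- c..c}" for i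
      using g by (auto simp: abs_le_iff minus_le_iff)
    show "real n * measure_pmf.expectation P g \<equiv> \<Sum>i<n. measure_pmf.expectation ?Q (\<lambda>x. g (x i))"
      by (rule eq_reflection) (simp add: ex)
  qed auto
  have "measure_pmf.prob ?Q {x\<in>space (measure_pmf ?Q). \<bar>(\<Sum>i<n. g (x i)) - n * measure_pmf.expectation P g\<bar> \<ge> n * \<epsilon>}
     \<le> 2 * exp (- 2 * (n * \<epsilon>)\<^sup>2 / (\<Sum>i<n. (c - - c)\<^sup>2))"
    by (rule Hoeffding_ineq_abs_ge) (use assms in auto)
  also have "- 2 * (n * \<epsilon>)\<^sup>2 / (\<Sum>i<n. (c - - c)\<^sup>2) = - (\<epsilon>\<^sup>2 / (2 * c\<^sup>2)) * n"
    using assms by (simp add: field_simps power2_eq_square)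
  also have "{x\<in>space (measure_pmf ?Q). \<bar>(\<Sum>i<n. g (x i)) - n * measure_pmf.expectation P g\<bar> \<ge> n * \<epsilon>} =
     {x. \<bar>(\<Sum>i<n. g (x i)) / n - measure_pmf.expectation P g\<bar> \<ge> \<epsilon>}"
  proof -
    have "\<bar>S - n * E\<bar> \<ge> n * \<epsilon> \<longleftrightarrow> \<bar>S / n - E\<bar> \<ge> \<epsilon>" for S E :: real
    proof -
      have "S - n * E = n * (S / n - E)" using assms by (simp add: field_simps)
      then show ?thesis using assms by (simp add: abs_mult)
    qed
    then show ?thesis by simp
  qed
  finally show ?thesis .
qed

text \<open>Only a first moment is available, so the letters are truncated: the bounded part is
  handled by Hoeffding's inequality, the remainder by Markov's.\<close>

lemma weak_law_Pi_pmf: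
  fixes g :: "'a \<Rightarrow> real"
  assumes int: "integrable (measure_pmf P) g" and e: "\<epsilon> > 0"
  shows "(\<lambda>n::nat. measure_pmf.prob (Pi_pmf ({..<n} :: nat set) d (\<lambda>_. P))
      {x. \<bar>(\<Sum>i<n. g (x i)) / n - measure_pmf.expectation P g\<bar> > \<epsilon>}) \<longlonglongrightarrow> 0"
proof (rule LIMSEQ_I)
  fix \<eta> :: real assume eta: "\<eta> > 0"
  \<comment> \<open>Bound for the mean of the discarded part: \<epsilon>/3 limits the shift of the
    expectation caused by truncation, and \<eta> \<epsilon>/9 brings Markov's bound 3 E h /
    \<epsilon> down to \<eta>/3.\<close>
  define r where "r = min (\<epsilon>/3) (\<eta> * \<epsilon> / 9)"
  have r: "r > 0" using e eta by (simp add: r_def)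
  let ?h = "\<lambda>c x. if \<bar>g x\<bar> \<le> real c then 0 else \<bar>g x\<bar>"
  obtain c0 where c0: "\<And>c. c \<ge> c0 \<Longrightarrow> norm (measure_pmf.expectation P (?h c) - 0) < r"
    using LIMSEQ_D[OF tendsto_expectation_truncated[OF int] r] by auto
  define c where "c = max 1 c0"
  have c: "real c > 0" "c \<ge> c0" by (auto simp: c_def)
  define h where "h = ?h c"
  have "integrable (measure_pmf P) h"
    unfolding h_def by (rule Bochner_Integration.integrable_bound[OF integrable_abs[OF int]]) auto
  note inth = this
  define g1 where "g1 x = (if \<bar>g x\<bar> \<le> real c then g x else 0)" for x
  have intg1: "integrable (measure_pmf P) g1"
    unfolding g1_def by (rule Bochner_Integration.integrable_bound[OF integrable_abs[OF int]]) auto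
  have h0: "h x \<ge> 0" for x by (simp add: h_def)
  have Eh: "measure_pmf.expectation P h < r" using c0[OF c(2)] by (simp add: h_def)
  have gh: "\<bar>g x - g1 x\<bar> \<le> h x" for x by (simp add: h_def g1_def)
  have Eg: "\<bar>measure_pmf.expectation P g - measure_pmf.expectation P g1\<bar> \<le> measure_pmf.expectation P h"
  proof -
    have "\<bar>measure_pmf.expectation P (\<lambda>x. g x - g1 x)\<bar> \<le> measure_pmf.expectation P (\<lambda>x. \<bar>g x - g1 x\<bar>)"
      by (rule integral_abs_bound)
    also have "\<dots> \<le> measure_pmf.expectation P h"
      by (rule integral_mono) (use int intg1 inth gh in auto)
    finally show ?thesis using int intg1 by simp
  qed
  have "(\<lambda>n. 2 * exp (- ((\<epsilon>/3)\<^sup>2 / (2 * (real c)\<^sup>2)) * real n)) \<longlonglongrightarrow> 0"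
  proof -
    define k where "k = (\<epsilon>/3)\<^sup>2 / (2 * (real c)\<^sup>2)"
    have "k > 0" using e c by (simp add: k_def)
    have "(\<lambda>n. 2 * exp (- k * real n)) \<longlonglongrightarrow> 2 * 0"
      by (intro tendsto_mult tendsto_const filterlim_compose[OF exp_at_bot]
          filterlim_tendsto_neg_mult_at_bot[OF tendsto_const] filterlim_real_sequentially)
         (use \<open>k > 0\<close> in auto)
    then show ?thesis by (simp add: k_def)
  qed
  from LIMSEQ_D[OF this, of "\<eta>/2"] eta obtain n0 where n0:
    "\<And>n. n \<ge> n0 \<Longrightarrow> 2 * exp (- ((\<epsilon>/3)\<^sup>2 / (2 * (real c)\<^sup>2)) * real n) < \<eta>/2"
    by auto
  show "\<exists>no. \<forall>n\<ge>no. norm (measure_pmf.prob (Pi_pmf ({..<n} :: nat set) d (\<lambda>_. P))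
      {x. \<bar>(\<Sum>i<n. g (x i)) / n - measure_pmf.expectation P g\<bar> > \<epsilon>} - 0) < \<eta>"
  proof (intro exI allI impI)
    fix n :: nat assume n: "n \<ge> max 1 n0"
    let ?Q = "Pi_pmf ({..<n} :: nat set) d (\<lambda>_. P)"
    let ?A = "{x. \<bar>(\<Sum>i<n. g1 (x i)) / n - measure_pmf.expectation P g1\<bar> \<ge> \<epsilon>/3}"
    let ?B = "{x. (\<Sum>i<n. h (x i)) \<ge> n * \<epsilon> / 3}"
    \<comment> \<open>Three sources of deviation, each below \<epsilon>/3 outside the two events:
      the truncated average, the average of \<open>h\<close>, and the shift of the mean.\<close>
    have sub: "{x. \<bar>(\<Sum>i<n. g (x i)) / n - measure_pmf.expectation P g\<bar> > \<epsilon>} \<subseteq> ?A \<union> ?B"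
    proof
      fix x assume x: "x \<in> {x. \<bar>(\<Sum>i<n. g (x i)) / n - measure_pmf.expectation P g\<bar> > \<epsilon>}"
      show "x \<in> ?A \<union> ?B"
      proof (rule ccontr)
        assume a: "x \<notin> ?A \<union> ?B"
        have "\<bar>(\<Sum>i<n. g (x i)) - (\<Sum>i<n. g1 (x i))\<bar> \<le> (\<Sum>i<n. h (x i))"
          unfolding sum_subtractf[symmetric] by (rule order_trans[OF sum_abs sum_mono]) (use gh in auto)
        also have "\<dots> < n * \<epsilon> / 3" using a by auto
        finally have "\<bar>((\<Sum>i<n. g (x i)) - (\<Sum>i<n. g1 (x i))) / n\<bar> < \<epsilon> / 3"
          using n by (simp add: abs_divide field_simps)
        moreover have "\<bar>(\<Sum>i<n. g1 (x i)) / n - measure_pmf.expectation P g1\<bar> < \<epsilon>/3"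
          using a by auto
        moreover have "r \<le> \<epsilon>/3" by (simp add: r_def)
        ultimately show False using x Eg Eh unfolding mem_Collect_eq diff_divide_distrib by argo
      qed
    qed
    have comp: "map_pmf (\<lambda>x. x i) ?Q = P" if "i < n" for i
      using that by (subst Pi_pmf_component) auto
    have intc: "integrable (measure_pmf ?Q) (\<lambda>x. h (x i))" if "i < n" for i
      using inth by (subst (asm) comp[OF that, symmetric]) simp
    have exc: "measure_pmf.expectation ?Q (\<lambda>x. h (x i)) = measure_pmf.expectation P h" if "i < n" for i
      by (subst comp[OF that, symmetric]) simp
    have "measure_pmf.prob ?Q ?B \<le> measure_pmf.expectation ?Q (\<lambda>x. \<Sum>i<n. h (x i)) / (n * \<epsilon> / 3)"
    proof -
      have "measure_pmf.prob ?Q {x \<in> space (measure_pmf ?Q). (\<Sum>i<n. h (x i)) \<ge> n * \<epsilon> / 3}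
         \<le> measure_pmf.expectation ?Q (\<lambda>x. \<Sum>i<n. h (x i)) / (n * \<epsilon> / 3)"
        by (rule integral_Markov_inequality_measure[where A="{}"])
           (use e n in \<open>auto intro!: sum_nonneg h0 Bochner_Integration.integrable_sum intc\<close>)
      then show ?thesis by simp
    qed
    also have "measure_pmf.expectation ?Q (\<lambda>x. \<Sum>i<n. h (x i)) = n * measure_pmf.expectation P h"
      by (subst Bochner_Integration.integral_sum) (auto simp: intc exc)
    also have "n * measure_pmf.expectation P h / (n * \<epsilon> / 3) = 3 * measure_pmf.expectation P h / \<epsilon>"
      using n e by (simp add: field_simps)
    also have "\<dots> \<le> 3 * (\<eta> * \<epsilon> / 9) / \<epsilon>"
      using Eh e by (intro divide_right_mono mult_left_mono) (auto simp: r_def)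
    also have "\<dots> < \<eta> / 2" using e eta by simp
    finally have B: "measure_pmf.prob ?Q ?B < \<eta>/2" .
    have "measure_pmf.prob ?Q ?A \<le> 2 * exp (- ((\<epsilon>/3)\<^sup>2 / (2 * (real c)\<^sup>2)) * real n)"
      by (rule Hoeffding_Pi_pmf) (use c e n in \<open>auto simp: g1_def\<close>)
    also have "\<dots> < \<eta>/2" using n0 n by simp
    finally have A: "measure_pmf.prob ?Q ?A < \<eta>/2" .
    have "measure_pmf.prob ?Q {x. \<bar>(\<Sum>i<n. g (x i)) / n - measure_pmf.expectation P g\<bar> > \<epsilon>} \<le> 
      measure_pmf.prob ?Q (?A \<union> ?B)"
      by (rule measure_pmf.finite_measure_mono[OF sub]) auto
    also have "\<dots> \<le> measure_pmf.prob ?Q ?A + measure_pmf.prob ?Q ?B"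
      by (rule measure_Un_le) auto
    also have "\<dots> < \<eta>" using A B by simp
    finally show "norm (measure_pmf.prob ?Q
      {x. \<bar>(\<Sum>i<n. g (x i)) / n - measure_pmf.expectation P g\<bar> > \<epsilon>} - 0) < \<eta>" by simp
  qed
qed

section \<open>Typicality holds with probability tending to 1\<close>

text \<open>An image point has at least the mass of each of its preimages, so on the support the
  logarithm of the image mass lies between that of the original mass and 0; integrability follows by
  domination.\<close>

lemma finite_entropy_pmf_map:
  assumes "finite_entropy_pmf P"
  shows "finite_entropy_pmf (map_pmf f P)"
proof -
  have "integrable (measure_pmf P) (\<lambda>x. log 2 (pmf P x))"
    using assms by (simp add: finite_entropy_pmf_iff)
  then have "integrable (measure_pmf P) (\<lambda>x. log 2 (pmf (map_pmf f P) (f x)))"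
  proof (rule Bochner_Integration.integrable_bound)
    show "AE x in measure_pmf P. norm (log 2 (pmf (map_pmf f P) (f x))) \<le> norm (log 2 (pmf P x))"
    proof (rule AE_pmfI)
      fix x assume x: "x \<in> set_pmf P"
      have "pmf P x \<le> pmf (map_pmf f P) (f x)"
        by (subst pmf_map, subst pmf.rep_eq) (intro measure_pmf.finite_measure_mono, auto)
      then have "log 2 (pmf P x) \<le> log 2 (pmf (map_pmf f P) (f x))"
        using x by (simp add: pmf_positive)
      moreover have "log 2 (pmf (map_pmf f P) (f x)) \<le> 0"
        using x by (subst log_le_zero_cancel_iff) (auto simp: pmf_le_1 pmf_positive)
      ultimately show "norm (log 2 (pmf (map_pmf f P) (f x))) \<le> norm (log 2 (pmf P x))" by simp
    qed
  qed auto
  then show ?thesis by (simp add: finite_entropy_pmf_iff)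
qed

lemma log_prod_pmf:
  fixes n :: nat
  assumes "\<And>i. i < n \<Longrightarrow> pmf p (x i) > 0"
  shows "log 2 (\<Prod>i<n. pmf p (x i)) = (\<Sum>i<n. log 2 (pmf p (x i)))"
  using assms unfolding log_def
  by (subst ln_prod) (auto simp: sum_divide_distrib less_le)

text \<open>The weak law for the log-probability of the letter \<open>f z\<close>, whose mean is
  minus the entropy of the image pmf. The map \<open>f\<close> is a parameter so that all marginals
  in joint typicality are instances.\<close>

lemma tendsto_prob_not_typical:
  fixes P :: "'a pmf" and f :: "'a \<Rightarrow> 'b::countable"
  assumes fin: "finite_entropy_pmf P" and e: "\<epsilon> > 0"
  shows "(\<lambda>n. measure_pmf.prob (Pi_pmf {..<n} d (\<lambda>_. P))
      {z. \<not> typical n \<epsilon> (map_pmf f P) (\<lambda>i. f (z i))}) \<longlonglongrightarrow> 0"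
proof -
  let ?p = "map_pmf f P"
  define g where "g z = log 2 (pmf ?p (f z))" for z
  have int: "integrable (measure_pmf P) g"
    using finite_entropy_pmf_map[OF fin, of f] by (simp add: finite_entropy_pmf_iff g_def[abs_def])
  have ent: "pmf_entropy ?p = - measure_pmf.expectation P g"
    by (simp add: pmf_entropy_eq g_def[abs_def])
  have le: "measure_pmf.prob (Pi_pmf {..<n} d (\<lambda>_. P)) {z. \<not> typical n \<epsilon> ?p (\<lambda>i. f (z i))}
    \<le> measure_pmf.prob (Pi_pmf ({..<n} :: nat set) d (\<lambda>_. P))
      {x. \<bar>(\<Sum>i<n. g (x i)) / n - measure_pmf.expectation P g\<bar> > \<epsilon>}" for n
  proof (rule measure_pmf.finite_measure_mono_AE, rule AE_pmfI, rule impI)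
    fix z assume z: "z \<in> set_pmf (Pi_pmf {..<n} d (\<lambda>_. P))"
      "z \<in> {z. \<not> typical n \<epsilon> ?p (\<lambda>i. f (z i))}"
    \<comment> \<open>Letters drawn from \<open>P\<close> have positive probability, so almost
      surely only the entropy condition of \<open>typical\<close> can fail.\<close>
    have "z i \<in> set_pmf P" if "i < n" for i
      using z(1) that by (auto simp: set_Pi_pmf PiE_dflt_def)
    then have pos: "pmf ?p (f (z i)) > 0" if "i < n" for i
      using that by (auto simp: pmf_positive_iff)
    from z(2) pos have "\<bar>- (1 / n) * (\<Sum>i<n. g (z i)) - pmf_entropy ?p\<bar> > \<epsilon>"
      unfolding typical_def g_def using log_prod_pmf[of n ?p "\<lambda>i. f (z i)"] by auto
    then show "z \<in> {x. \<bar>(\<Sum>i<n. g (x i)) / n - measure_pmf.expectation P g\<bar> > \<epsilon>}"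
      by (simp add: ent abs_minus_commute)
  qed auto
  show ?thesis
    by (rule tendsto_sandwich[OF _ _ tendsto_const weak_law_Pi_pmf[OF int e, of d]])
       (use le in auto)
qed

lemma typical_prod_bounds:
  assumes "typical n \<epsilon> p x" "n > 0"
  shows "2 powr (- (real n * (pmf_entropy p + \<epsilon>))) \<le> (\<Prod>i<n. pmf p (x i))"
    and "(\<Prod>i<n. pmf p (x i)) \<le> 2 powr (- (real n * (pmf_entropy p - \<epsilon>)))"
proof -
  let ?q = "\<Prod>i<n. pmf p (x i)"
  have q: "?q > 0" using assms by (auto simp: typical_def intro!: prod_pos)
  have "\<bar>- (1 / real n) * log 2 ?q - pmf_entropy p\<bar> \<le> \<epsilon>"
    using assms by (auto simp: typical_def)
  then have "- (real n * (pmf_entropy p + \<epsilon>)) \<le> log 2 ?q" "log 2 ?q \<le> - (real n * (pmf_entropy p - \<epsilon>))"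
    using assms(2) by (auto simp: abs_le_iff field_simps)
  then show "2 powr (- (real n * (pmf_entropy p + \<epsilon>))) \<le> ?q" "?q \<le> 2 powr (- (real n * (pmf_entropy p - \<epsilon>)))"
    using q by (auto simp: le_log_iff log_le_iff)
qed

text \<open>Union bound over the seven conditions, one projection each; the identity map stands for
  the full triple.\<close>

lemma tendsto_prob_jointly_typical:
  fixes P :: "('a::countable \<times> 'b::countable \<times> 'c::countable) pmf"
  assumes fin: "finite_entropy_pmf P" and e: "\<epsilon> > 0"
  shows "(\<lambda>n. measure_pmf.prob (Pi_pmf {..<n} d (\<lambda>_. P))
      {z. \<not> jointly_typical3 n \<epsilon> P (\<lambda>i. fst (z i)) (\<lambda>i. fst (snd (z i))) (\<lambda>i. snd (snd (z i)))}) \<longlonglongrightarrow> 0"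
proof -
  let ?N = "\<lambda>f n. {z. \<not> typical n \<epsilon> (map_pmf f P) (\<lambda>i. f (z i))}"
  let ?Q = "\<lambda>n. Pi_pmf {..<n} d (\<lambda>_. P)"
  let ?pr = "\<lambda>f n. measure_pmf.prob (?Q n) {z. \<not> typical n \<epsilon> (map_pmf f P) (\<lambda>i. f (z i))}"
  let ?f1 = "\<lambda>(a, s, y). a" and ?f2 = "\<lambda>(a, s, y). s" and ?f3 = "\<lambda>(a, s, y). y"
    and ?f4 = "\<lambda>(a, s, y). (a, s)" and ?f5 = "\<lambda>(a, s, y). (a, y)" and ?f6 = "\<lambda>(a, s, y). (s, y)"
    and ?f7 = "\<lambda>x. x"
  note lim = tendsto_prob_not_typical[OF fin e, of d]
  have "(\<lambda>n. ?pr ?f1 n + (?pr ?f2 n + (?pr ?f3 n + (?pr ?f4 n + (?pr ?f5 n + (?pr ?f6 n + ?pr ?f7 n))))))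
     \<longlonglongrightarrow> 0 + (0 + (0 + (0 + (0 + (0 + 0)))))"
    by (intro tendsto_add lim)
  then have lim': "(\<lambda>n. ?pr ?f1 n + (?pr ?f2 n + (?pr ?f3 n + (?pr ?f4 n + (?pr ?f5 n + (?pr ?f6 n + ?pr ?f7 n))))))
     \<longlonglongrightarrow> 0" by simp
  have le: "measure_pmf.prob (?Q n)
      {z. \<not> jointly_typical3 n \<epsilon> P (\<lambda>i. fst (z i)) (\<lambda>i. fst (snd (z i))) (\<lambda>i. snd (snd (z i)))}
     \<le> ?pr ?f1 n + (?pr ?f2 n + (?pr ?f3 n + (?pr ?f4 n + (?pr ?f5 n + (?pr ?f6 n + ?pr ?f7 n)))))" for n
  proof -
    have "{z. \<not> jointly_typical3 n \<epsilon> P (\<lambda>i. fst (z i)) (\<lambda>i. fst (snd (z i))) (\<lambda>i. snd (snd (z i)))}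
      \<subseteq> ?N ?f1 n \<union> (?N ?f2 n \<union> (?N ?f3 n \<union> (?N ?f4 n \<union> (?N ?f5 n \<union> (?N ?f6 n \<union> ?N ?f7 n)))))"
      by (auto simp: jointly_typical3_def case_prod_beta')
    then have "measure_pmf.prob (?Q n)
      {z. \<not> jointly_typical3 n \<epsilon> P (\<lambda>i. fst (z i)) (\<lambda>i. fst (snd (z i))) (\<lambda>i. snd (snd (z i)))}
      \<le> measure_pmf.prob (?Q n) (?N ?f1 n \<union> (?N ?f2 n \<union> (?N ?f3 n \<union> (?N ?f4 n \<union> (?N ?f5 n \<union> (?N ?f6 n \<union> ?N ?f7 n))))))"
      by (rule measure_pmf.finite_measure_mono) auto
    also have "\<dots> \<le> ?pr ?f1 n + (?pr ?f2 n + (?pr ?f3 n + (?pr ?f4 n + (?pr ?f5 n + (?pr ?f6 n + ?pr ?f7 n)))))"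
      by (intro order_trans[OF measure_Un_le] add_left_mono) auto
    finally show ?thesis .
  qed
  show ?thesis
    by (rule tendsto_sandwich[OF _ _ tendsto_const lim']) (use le in auto)
qed

section \<open>The joint distribution of amplitude, sign and output\<close>

text \<open>Change of measure. The bound on masses is demanded only where \<open>f\<close> is
  nonzero, so that with an indicator it need only hold on the typical set.\<close>

lemma nn_integral_pmf_le:
  fixes P R :: "'a pmf"
  assumes le: "\<And>z. f z \<noteq> 0 \<Longrightarrow> pmf R z \<le> c * pmf P z" and c: "c \<ge> 0"
  shows "nn_integral (measure_pmf R) f \<le> ennreal c * nn_integral (measure_pmf P) f"
proof -
  have "nn_integral (measure_pmf R) f = (\<integral>\<^sup>+z. ennreal (pmf R z) * f z \<partial>count_space UNIV)"
    by (rule nn_integral_measure_pmf)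
  also have "\<dots> \<le> (\<integral>\<^sup>+z. ennreal c * (ennreal (pmf P z) * f z) \<partial>count_space UNIV)"
  proof (rule nn_integral_mono)
    fix z
    show "ennreal (pmf R z) * f z \<le> ennreal c * (ennreal (pmf P z) * f z)"
    proof (cases "f z = 0")
      case False
      have "ennreal (pmf R z) \<le> ennreal c * ennreal (pmf P z)"
        using le[OF False] c by (simp add: ennreal_mult[symmetric] ennreal_leI)
      from mult_right_mono[OF this, of "f z"] show ?thesis by (simp add: mult.assoc)
    qed simp
  qed
  also have "\<dots> = ennreal c * (\<integral>\<^sup>+z. ennreal (pmf P z) * f z \<partial>count_space UNIV)"
    by (rule nn_integral_cmult) simp
  also have "(\<integral>\<^sup>+z. ennreal (pmf P z) * f z \<partial>count_space UNIV) = nn_integral (measure_pmf P) f"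
    by (rule nn_integral_measure_pmf[symmetric])
  finally show ?thesis .
qed

lemma prob_bind_pmf:
  "measure_pmf.prob (bind_pmf p f) A = measure_pmf.expectation p (\<lambda>x. measure_pmf.prob (f x) A)"
proof -
  have int: "integrable (measure_pmf p) (\<lambda>x. measure_pmf.prob (f x) A)"
    by (rule measure_pmf.integrable_const_bound[where B=1]) auto
  have "ennreal (measure_pmf.prob (bind_pmf p f) A) = (\<integral>\<^sup>+x. ennreal (measure_pmf.prob (f x) A) \<partial>p)"
    by (simp add: measure_pmf.emeasure_eq_measure[symmetric])
  also have "\<dots> = ennreal (measure_pmf.expectation p (\<lambda>x. measure_pmf.prob (f x) A))"
    by (rule nn_integral_eq_integral[OF int]) simp
  finally show ?thesis by (simp add: integral_nonneg_AE)
qed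

section \<open>Product distributions of amplitudes, signs and outputs\<close>

lemma typical_cong:
  assumes "\<And>i. i < n \<Longrightarrow> x i = x' i"
  shows "typical n \<epsilon> p x \<longleftrightarrow> typical n \<epsilon> p x'"
proof -
  have "(\<Prod>i<n. pmf p (x i)) = (\<Prod>i<n. pmf p (x' i))" by (rule prod.cong) (use assms in auto)
  then show ?thesis using assms by (auto simp: typical_def)
qed

text \<open>Only letters below \<open>n\<close> count. This removes the \<open>undefined\<close>
  padding that appears when a sequence of tuples is split into its component sequences.\<close>

lemma jointly_typical3_cong:
  assumes "\<And>i. i < n \<Longrightarrow> a i = a' i" "\<And>i. i < n \<Longrightarrow> s i = s' i" "\<And>i. i < n \<Longrightarrow> y i = y' i"
  shows "jointly_typical3 n \<epsilon> P a s y \<longleftrightarrow> jointly_typical3 n \<epsilon> P a' s' y'"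
  unfolding jointly_typical3_def
  by (intro arg_cong2[where f="(\<and>)"] typical_cong) (use assms in auto)

text \<open>The amplitude-sign pair and the output are made independent by letting \<open>y\<close> be the response
  to another, independent pair, as is the case for a competing codeword.\<close>

definition indep_joint_pmf :: "int pmf \<Rightarrow> (int \<Rightarrow> 'y pmf) \<Rightarrow> (int \<times> int \<times> 'y) pmf" where
  "indep_joint_pmf p W =
     do { a \<leftarrow> p; s \<leftarrow> pmf_of_set signs; y \<leftarrow> W (s * a);
          a' \<leftarrow> p; s' \<leftarrow> pmf_of_set signs; return_pmf (a', s', y) }"

abbreviation iid_pmf :: "nat \<Rightarrow> 'a pmf \<Rightarrow> (nat \<Rightarrow> 'a) pmf" where
  "iid_pmf n p \<equiv> Pi_pmf {..<n} undefined (\<lambda>_. p)"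

text \<open>Drawing signs and outputs letter by letter amounts to drawing a whole sign sequence
  first and then using the channel \<open>n\<close> times. This ties the probability in
  \<open>B_typical\<close> to randomly chosen signs of a codeword.\<close>

lemma Pi_pmf_sign_output:
  "Pi_pmf {..<n} undefined (\<lambda>i. sign_output W (a i)) =
     do { s \<leftarrow> iid_pmf n (pmf_of_set signs); y \<leftarrow> memoryless_output n W (\<lambda>i. a i * s i);
          return_pmf (\<lambda>i. if i \<in> {..<n} then (s i, y i) else undefined) }"
  unfolding sign_output_def memoryless_output_def
  by (simp add: Pi_pmf_bind[where d'=undefined] mult.commute)

lemma joint_pmf_eq:
  "joint_pmf p W = do { a \<leftarrow> p; v \<leftarrow> sign_output W a; return_pmf (a, v) }"
  by (simp add: joint_pmf_def case_prod_beta')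

lemma iid_joint_pmf:
  "iid_pmf n (joint_pmf p W) =
     do { a \<leftarrow> iid_pmf n p; v \<leftarrow> Pi_pmf {..<n} undefined (\<lambda>i. sign_output W (a i));
          return_pmf (\<lambda>i. if i \<in> {..<n} then (a i, v i) else undefined) }"
  unfolding joint_pmf_eq
  by (simp add: Pi_pmf_bind[where d'=undefined])

lemma iid_indep_joint_pmf:
  "iid_pmf n (indep_joint_pmf p W) =
     do { a \<leftarrow> iid_pmf n p; s \<leftarrow> iid_pmf n (pmf_of_set signs);
          y \<leftarrow> memoryless_output n W (\<lambda>i. a i * s i);
          a' \<leftarrow> iid_pmf n p; s' \<leftarrow> iid_pmf n (pmf_of_set signs);
          return_pmf (\<lambda>i. if i \<in> {..<n} then (a' i, s' i, y i) else undefined) }"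
  unfolding indep_joint_pmf_def memoryless_output_def
  by (simp add: Pi_pmf_bind[where d'=undefined] mult.commute)

text \<open>Up to the order of components, \<open>indep_joint_pmf\<close> is the
  \<open>pair_pmf\<close> of the output marginal and the amplitude-sign marginal.\<close>

lemma pmf_indep_joint_pmf:
  "pmf (indep_joint_pmf p W) (a, s, y) =
     pmf (map_pmf (\<lambda>(a, s, y). (a, s)) (joint_pmf p W)) (a, s) *
     pmf (map_pmf (\<lambda>(a, s, y). y) (joint_pmf p W)) y"
proof -
  let ?AS = "map_pmf (\<lambda>(a, s, y). (a, s)) (joint_pmf p W)"
  let ?Y = "map_pmf (\<lambda>(a, s, y). y) (joint_pmf p W)"
  have AS: "?AS = do { a \<leftarrow> p; s \<leftarrow> pmf_of_set signs; return_pmf (a, s) }"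
    by (simp add: joint_pmf_def sign_output_def map_pmf_def bind_assoc_pmf bind_return_pmf)
  have Y: "?Y = do { a \<leftarrow> p; s \<leftarrow> pmf_of_set signs; W (s * a) }"
    by (simp add: joint_pmf_def sign_output_def map_pmf_def bind_assoc_pmf bind_return_pmf bind_return_pmf')
  have "indep_joint_pmf p W = map_pmf (\<lambda>(y, a, s). (a, s, y)) (pair_pmf ?Y ?AS)"
    unfolding AS Y
    by (simp add: indep_joint_pmf_def pair_pmf_def map_pmf_def bind_assoc_pmf bind_return_pmf)
  moreover have "pmf (map_pmf (\<lambda>(y, a, s). (a, s, y)) (pair_pmf ?Y ?AS)) ((\<lambda>(y, a, s). (a, s, y)) (y, a, s))
      = pmf (pair_pmf ?Y ?AS) (y, a, s)"
    by (rule pmf_map_inj') (auto simp: inj_on_def)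
  ultimately show ?thesis by (simp add: pmf_pair)
qed

section \<open>Mutual information and typicality of independent triples\<close>

lemma integral_pmf_count_space:
  fixes f :: "'a \<Rightarrow> real"
  shows "(\<integral>x. pmf p x * f x \<partial>count_space UNIV) = measure_pmf.expectation p f"
  using integral_density[of f "count_space UNIV" "pmf p"]
  by (simp add: measure_pmf_eq_density[symmetric])

text \<open>On the support the logarithm of the quotient splits into three terms, each integrable
  because marginals inherit finite entropy.\<close>

lemma mutual_info_SA_Y_entropy:
  fixes W :: "int \<Rightarrow> 'y::countable pmf"
  assumes fin: "finite_entropy_pmf (joint_pmf p W)"
  shows "mutual_info_SA_Y p W =
    pmf_entropy (map_pmf (\<lambda>(a, s, y). (a, s)) (joint_pmf p W)) +
    pmf_entropy (map_pmf (\<lambda>(a, s, y). y) (joint_pmf p W)) - pmf_entropy (joint_pmf p W)"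
proof -
  let ?J = "joint_pmf p W"
  let ?h = "\<lambda>(a, s, y). ((s, a), y)"
  let ?AS = "map_pmf (\<lambda>(a, s, y). (a, s)) ?J"
  let ?Y = "map_pmf (\<lambda>(a, s, y). y) ?J"
  \<comment> \<open>Mutual information arranges the letters as ((s, a), y), typicality as (a, s, y).
    The rearrangement is injective, so masses carry over.\<close>
  define Q where "Q = map_pmf ?h ?J"
  have Q: "pmf Q (?h z) = pmf ?J z" for z
    unfolding Q_def by (rule pmf_map_inj') (auto simp: inj_on_def)
  have "map_pmf fst Q = map_pmf prod.swap ?AS"
    by (auto simp: Q_def map_pmf_comp intro!: map_pmf_cong)
  then have Q1: "pmf (map_pmf fst Q) (s, a) = pmf ?AS (a, s)" for a s
    using pmf_map_inj'[of prod.swap ?AS "(a, s)"] by simp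
  have Q2: "map_pmf snd Q = ?Y"
    by (auto simp: Q_def map_pmf_comp intro!: map_pmf_cong)
  have i1: "integrable (measure_pmf ?J) (\<lambda>z. log 2 (pmf ?J z))"
    using fin by (simp add: finite_entropy_pmf_iff)
  have i2: "integrable (measure_pmf ?J) (\<lambda>z. log 2 (pmf ?AS ((\<lambda>(a, s, y). (a, s)) z)))"
    using finite_entropy_pmf_map[OF fin, of "\<lambda>(a, s, y). (a, s)"] by (simp add: finite_entropy_pmf_iff)
  have i3: "integrable (measure_pmf ?J) (\<lambda>z. log 2 (pmf ?Y ((\<lambda>(a, s, y). y) z)))"
    using finite_entropy_pmf_map[OF fin, of "\<lambda>(a, s, y). y"] by (simp add: finite_entropy_pmf_iff)
  have "mutual_info_SA_Y p W = measure_pmf.expectation Q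
     (\<lambda>z. log 2 (pmf Q z / (pmf (map_pmf fst Q) (fst z) * pmf (map_pmf snd Q) (snd z))))"
    unfolding mutual_info_SA_Y_eq Q_def[symmetric] by (rule integral_pmf_count_space)
  also have "\<dots> = measure_pmf.expectation ?J
     (\<lambda>z. log 2 (pmf Q (?h z) / (pmf (map_pmf fst Q) (fst (?h z)) * pmf (map_pmf snd Q) (snd (?h z)))))"
    unfolding Q_def by simp
  also have "\<dots> = measure_pmf.expectation ?J (\<lambda>z. log 2 (pmf ?J z) -
       log 2 (pmf ?AS ((\<lambda>(a, s, y). (a, s)) z)) - log 2 (pmf ?Y ((\<lambda>(a, s, y). y) z)))"
  proof (rule integral_cong_AE; (rule AE_pmfI)?)
    fix z assume z: "z \<in> set_pmf ?J"
    obtain a s y where zz: "z = (a, s, y)" by (cases z) auto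
    have "pmf ?J z > 0" using z by (simp add: pmf_positive)
    moreover have "pmf ?AS (a, s) > 0" "pmf ?Y y > 0"
      using z unfolding zz pmf_positive_iff by force+
    ultimately show "log 2 (pmf Q (?h z) / (pmf (map_pmf fst Q) (fst (?h z)) * pmf (map_pmf snd Q) (snd (?h z)))) =
      log 2 (pmf ?J z) -
       log 2 (pmf ?AS ((\<lambda>(a, s, y). (a, s)) z)) - log 2 (pmf ?Y ((\<lambda>(a, s, y). y) z))"
      unfolding Q by (simp add: zz Q1 Q2 log_divide_pos log_mult_pos)
  qed auto
  also have "\<dots> = measure_pmf.expectation ?J (\<lambda>z. log 2 (pmf ?J z)) -
       measure_pmf.expectation ?J (\<lambda>z. log 2 (pmf ?AS ((\<lambda>(a, s, y). (a, s)) z))) -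
       measure_pmf.expectation ?J (\<lambda>z. log 2 (pmf ?Y ((\<lambda>(a, s, y). y) z)))"
    using i1 i2 i3 by simp
  also have "\<dots> = pmf_entropy ?AS + pmf_entropy ?Y - pmf_entropy ?J"
    unfolding pmf_entropy_eq by simp
  finally show ?thesis .
qed

text \<open>On the typical set the independent law has mass at most 2^(-n (H(AS) + H(Y) - 2
  \<epsilon>)) and the joint law at least 2^(-n (H(ASY) + \<epsilon>)). Their ratio is thus at most
  the claimed bound, and the joint law has total mass 1; the 3 \<epsilon> collects one \<epsilon>
  per condition.\<close>

lemma prob_indep_typical_le:
  fixes W :: "int \<Rightarrow> 'y::countable pmf"
  assumes fin: "finite_entropy_pmf (joint_pmf p W)" and n: "n > 0"
  shows "measure_pmf.prob (iid_pmf n (indep_joint_pmf p W))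
     {z. jointly_typical3 n \<epsilon> (joint_pmf p W) (\<lambda>i. fst (z i)) (\<lambda>i. fst (snd (z i))) (\<lambda>i. snd (snd (z i)))}
   \<le> 2 powr (- (real n * (mutual_info_SA_Y p W - 3 * \<epsilon>)))" (is "measure_pmf.prob ?R ?T \<le> ?c")
proof -
  let ?J = "joint_pmf p W"
  let ?AS = "map_pmf (\<lambda>(a, s, y). (a, s)) ?J"
  let ?Y = "map_pmf (\<lambda>(a, s, y). y) ?J"
  let ?P = "iid_pmf n ?J"
  have le: "pmf ?R z \<le> ?c * pmf ?P z" if "z \<in> ?T" for z
  proof (cases "\<forall>i. i \<notin> {..<n} \<longrightarrow> z i = undefined")
    case True
    let ?as = "\<lambda>i. (fst (z i), fst (snd (z i)))" and ?y = "\<lambda>i. snd (snd (z i))"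
    have t: "typical n \<epsilon> ?AS ?as" "typical n \<epsilon> ?Y ?y" "typical n \<epsilon> ?J z"
      using that by (auto simp: jointly_typical3_def)
    have "pmf ?R z = (\<Prod>i<n. pmf ?AS (?as i) * pmf ?Y (?y i))"
      using True by (subst pmf_Pi') (auto simp: pmf_indep_joint_pmf[symmetric])
    also have "\<dots> = (\<Prod>i<n. pmf ?AS (?as i)) * (\<Prod>i<n. pmf ?Y (?y i))"
      by (rule prod.distrib)
    also have "\<dots> \<le> 2 powr (- (real n * (pmf_entropy ?AS - \<epsilon>))) * 2 powr (- (real n * (pmf_entropy ?Y - \<epsilon>)))"
      by (intro mult_mono typical_prod_bounds t n prod_nonneg) auto
    also have "\<dots> = ?c * 2 powr (- (real n * (pmf_entropy ?J + \<epsilon>)))"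
      unfolding mutual_info_SA_Y_entropy[OF fin] powr_add[symmetric] by (simp add: algebra_simps)
    also have "\<dots> \<le> ?c * (\<Prod>i<n. pmf ?J (z i))"
      by (intro mult_left_mono typical_prod_bounds t n) auto
    also have "(\<Prod>i<n. pmf ?J (z i)) = pmf ?P z"
      using True by (subst pmf_Pi') auto
    finally show ?thesis .
  next
    \<comment> \<open>Both product distributions vanish at a function that is not
      \<open>undefined\<close> off the block.\<close>
    case False
    then show ?thesis by (auto simp: pmf_Pi)
  qed
  have "emeasure ?R ?T = (\<integral>\<^sup>+z. indicator ?T z \<partial>?R)" by simp
  also have "\<dots> \<le> ennreal ?c * (\<integral>\<^sup>+z. indicator ?T z \<partial>?P)"
    by (rule nn_integral_pmf_le) (use le in \<open>auto simp: indicator_def split: if_splits\<close>)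
  also have "\<dots> \<le> ennreal ?c * 1"
    by (intro mult_left_mono) (auto simp: measure_pmf.emeasure_le_1)
  finally show ?thesis by (simp add: measure_pmf.emeasure_eq_measure)
qed

section \<open>Random coding\<close>

lemma exists_le_average:
  fixes f :: "'a \<Rightarrow> real" and c :: real
  assumes "finite B" "B \<noteq> {}" "(\<Sum>x\<in>B. f x) \<le> card B * c"
  shows "\<exists>x\<in>B. f x \<le> c"
proof (rule ccontr)
  assume "\<not> (\<exists>x\<in>B. f x \<le> c)"
  then have "(\<Sum>x\<in>B. c) < (\<Sum>x\<in>B. f x)"
    using assms by (intro sum_strict_mono) (auto simp: not_le)
  then show False using assms by simp
qed

text \<open>Elements are deleted one at a time, each time one for which the (suitably normalised)
  objective does not exceed its average over all possible deletions.\<close>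

lemma exists_subset_le_average:
  fixes e :: "'a \<Rightarrow> real" and c :: "'a \<Rightarrow> 'a \<Rightarrow> real"
  assumes "finite B" "1 \<le> K" "K \<le> card B"
    and diag: "\<And>u. c u u = 0"
  shows "\<exists>T\<subseteq>B. card T = K \<and>
    (\<Sum>u\<in>T. e u) / K + (real K - 1) * (\<Sum>u\<in>T. \<Sum>v\<in>T. c u v) / (K * (real K - 1)) \<le>
    (\<Sum>u\<in>B. e u) / card B + (real K - 1) * (\<Sum>u\<in>B. \<Sum>v\<in>B. c u v) / (card B * (real (card B) - 1))"
  using assms(1,3)
proof (induction "card B - K" arbitrary: B)
  case 0
  then show ?case by (intro exI[of _ B]) auto
next
  case (Suc j)
  define N where "N = card B"
  have N: "N > K" "N \<ge> 2" using Suc assms(2) by (auto simp: N_def)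
  define E where "E A = (\<Sum>u\<in>A. e u)" for A
  define C where "C A = (\<Sum>u\<in>A. \<Sum>v\<in>A. c u v)" for A
  have "B \<noteq> {}" using N by (auto simp: N_def)
  have E1: "E (B - {x}) = E B - e x" if "x \<in> B" for x
    using that Suc.prems by (simp add: E_def sum_diff1)
  \<comment> \<open>Deleting \<open>x\<close> removes its row and its column; since the diagonal is
    zero, their common entry causes no correction.\<close>
  have C1: "C (B - {x}) = C B - (\<Sum>v\<in>B. c x v) - (\<Sum>u\<in>B. c u x)" if x: "x \<in> B" for x
  proof -
    have "C (B - {x}) = (\<Sum>u\<in>B-{x}. (\<Sum>v\<in>B. c u v) - c u x)"
      using x Suc.prems by (simp add: C_def sum_diff1)
    also have "\<dots> = (\<Sum>u\<in>B-{x}. (\<Sum>v\<in>B. c u v)) - (\<Sum>u\<in>B-{x}. c u x)"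
      by (rule sum_subtractf)
    also have "\<dots> = C B - (\<Sum>v\<in>B. c x v) - (\<Sum>u\<in>B. c u x)"
      using x Suc.prems diag by (simp add: C_def sum_diff1)
    finally show ?thesis .
  qed
  \<comment> \<open>Of the N deletions, a given element survives N - 1 and a given ordered pair of
    distinct elements N - 2. The normalisations by N and N (N - 1) therefore keep both averages
    unchanged.\<close>
  have "(\<Sum>x\<in>B. E (B - {x})) = (real N - 1) * E B"
  proof -
    have "(\<Sum>x\<in>B. E (B - {x})) = (\<Sum>x\<in>B. E B - e x)" by (intro sum.cong refl E1)
    also have "\<dots> = N * E B - E B" unfolding sum_subtractf by (simp add: N_def E_def)
    finally show ?thesis by (simp add: algebra_simps)
  qed
  moreover have "(\<Sum>x\<in>B. C (B - {x})) = (real N - 2) * C B"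
  proof -
    have "(\<Sum>x\<in>B. \<Sum>u\<in>B. c u x) = C B" unfolding C_def by (rule sum.swap)
    moreover have "(\<Sum>x\<in>B. \<Sum>v\<in>B. c x v) = C B" unfolding C_def ..
    moreover have "(\<Sum>x\<in>B. C (B - {x})) = (\<Sum>x\<in>B. C B - (\<Sum>v\<in>B. c x v) - (\<Sum>u\<in>B. c u x))"
      by (intro sum.cong refl C1)
    ultimately have "(\<Sum>x\<in>B. C (B - {x})) = N * C B - C B - C B"
      unfolding sum_subtractf by (simp add: N_def)
    then show ?thesis by (simp add: algebra_simps)
  qed
  ultimately have "(\<Sum>x\<in>B. E (B - {x}) / (real N - 1) + (real K - 1) * C (B - {x}) / ((real N - 1) * (real N - 2)))
    = (real N - 1) * E B / (real N - 1) + (real K - 1) * ((real N - 2) * C B) / ((real N - 1) * (real N - 2))"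
    by (simp add: sum.distrib sum_divide_distrib[symmetric] sum_distrib_left[symmetric])
  also have "\<dots> = card B * (E B / N + (real K - 1) * C B / (N * (real N - 1)))"
  \<comment> \<open>Here the denominator N - 2 is zero and the quotient is 0 by convention; this is
    harmless because then K = 1 and the pair term carries the factor K - 1.\<close>
  proof (cases "N = 2")
    case True
    then have "K = 1" using N assms by simp
    then show ?thesis using True N_def by simp
  next
    case False
    then have "real N > 2" using N by simp
    then show ?thesis by (simp add: N_def[symmetric] divide_simps) 
  qed
  finally have "\<exists>x\<in>B. E (B - {x}) / (real N - 1) + (real K - 1) * C (B - {x}) / ((real N - 1) * (real N - 2))
    \<le> E B / N + (real K - 1) * C B / (N * (real N - 1))"
    by (intro exists_le_average Suc.prems(1) \<open>B \<noteq> {}\<close> eq_refl)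
  then obtain x where x: "x \<in> B" and le: "E (B - {x}) / (real N - 1) + (real K - 1) * C (B - {x}) / ((real N - 1) * (real N - 2))
    \<le> E B / N + (real K - 1) * C B / (N * (real N - 1))" by blast
  have card: "card (B - {x}) = N - 1" using x Suc.prems by (simp add: N_def)
  have r: "real (N - 1) = real N - 1" using N by simp
  have "j = card (B - {x}) - K" "finite (B - {x})" "K \<le> card (B - {x})"
    using Suc.hyps(2) Suc.prems N unfolding card by (auto simp: N_def)
  from Suc.hyps(1)[OF this] have "\<exists>T\<subseteq>B - {x}. card T = K \<and>
    E T / K + (real K - 1) * C T / (K * (real K - 1)) \<le>
     E (B - {x}) / (real N - 1) + (real K - 1) * C (B - {x}) / ((real N - 1) * (real N - 1 - 1))"
    unfolding E_def C_def card r .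
  then obtain T where T: "T \<subseteq> B - {x}" "card T = K"
    "E T / K + (real K - 1) * C T / (K * (real K - 1)) \<le>
     E (B - {x}) / (real N - 1) + (real K - 1) * C (B - {x}) / ((real N - 1) * (real N - 2))"
    by auto
  have "E T / K + (real K - 1) * C T / (K * (real K - 1)) \<le> E B / N + (real K - 1) * C B / (N * (real N - 1))"
    using T(3) le by (rule order_trans)
  with T(1,2) show ?case
    unfolding E_def C_def N_def by blast
qed

text \<open>Pairwise independence of coordinates, seen by splitting off \<open>u\<close> from the
  product. It is applied to the random signs of two different codewords.\<close>

lemma map_Pi_pmf_pair:
  assumes "finite B" "u \<in> B" "v \<in> B" "u \<noteq> v"
  shows "map_pmf (\<lambda>f. (f u, f v)) (Pi_pmf B d p) = pair_pmf (p u) (p v)"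
proof -
  define A where "A = B - {u}"
  have B: "B = insert u A" "u \<notin> A" "finite A" "v \<in> A" using assms by (auto simp: A_def)
  have "Pi_pmf B d p = map_pmf (\<lambda>(y,f). f(u:=y)) (pair_pmf (p u) (Pi_pmf A d p))"
    unfolding B(1) by (rule Pi_pmf_insert[OF B(3,2)])
  then have "map_pmf (\<lambda>f. (f u, f v)) (Pi_pmf B d p)
     = map_pmf (\<lambda>(y, f). (y, f v)) (pair_pmf (p u) (Pi_pmf A d p))"
    using assms(4) by (simp add: map_pmf_comp case_prod_beta')
  also have "\<dots> = pair_pmf (p u) (map_pmf (\<lambda>f. f v) (Pi_pmf A d p))"
    using map_pair[of "\<lambda>y. y" "\<lambda>f. f v" "p u" "Pi_pmf A d p"] by (simp add: pmf.map_ident)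
  also have "map_pmf (\<lambda>f. f v) (Pi_pmf A d p) = p v"
    using B(3,4) by (simp add: Pi_pmf_component)
  finally show ?thesis .
qed

lemma pmf_exists_le_expectation:
  fixes f :: "'a \<Rightarrow> real"
  assumes "integrable (measure_pmf p) f"
  shows "\<exists>x\<in>set_pmf p. f x \<le> measure_pmf.expectation p f"
proof (rule ccontr)
  assume "\<not> (\<exists>x\<in>set_pmf p. f x \<le> measure_pmf.expectation p f)"
  then have "measure_pmf.expectation p f < measure_pmf.expectation p f"
    by (intro measure_pmf.expectation_greater assms AE_pmfI) auto
  then show False by simp
qed

text \<open>Here \<open>e\<close> is the error due to a codeword itself and \<open>c\<close> its
  confusion with a competitor. First a sign assignment on all of \<open>B\<close> is fixed whose
  objective \<open>F\<close> does not exceed its mean, then \<open>B\<close> is thinned to K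
  elements; \<open>F\<close> already weighs pairs for a code of size K. Admitting the pairs u = v on
  the right only enlarges the bound and makes both codewords independent and uniform.\<close>

lemma random_coding:
  fixes e :: "'a \<Rightarrow> 's \<Rightarrow> real" and c :: "'a \<Rightarrow> 's \<Rightarrow> 'a \<Rightarrow> 's \<Rightarrow> real"
  assumes B: "finite B" and K: "1 \<le> K" "K \<le> card B"
    and e: "\<And>u s. 0 \<le> e u s" "\<And>u s. e u s \<le> 1"
    and c: "\<And>u s v t. 0 \<le> c u s v t" "\<And>u s v t. c u s v t \<le> 1"
  shows "\<exists>T s. T \<subseteq> B \<and> card T = K \<and> (\<forall>u\<in>B. s u \<in> set_pmf \<sigma>) \<and>
    (\<Sum>u\<in>T. e u (s u) + (\<Sum>v\<in>T-{u}. c u (s u) v (s v))) / K \<le>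
    (\<Sum>u\<in>B. measure_pmf.expectation \<sigma> (e u)) / card B +
    2 * (real K - 1) * (\<Sum>u\<in>B. \<Sum>v\<in>B. measure_pmf.expectation (pair_pmf \<sigma> \<sigma>) (\<lambda>(s, t). c u s v t)) / (real (card B))\<^sup>2"
proof -
  define N where "N = real (card B)"
  \<comment> \<open>Zero on the diagonal, as the thinning lemma requires; pairs u = v would also
    lack independent signs.\<close>
  define c' where "c' u s v t = (if u = v then 0 else c u s v t)" for u s v t
  define \<Sigma> where "\<Sigma> = Pi_pmf B undefined (\<lambda>_. \<sigma>)"
  \<comment> \<open>Weight of an ordered pair: each codeword has K - 1 competitors, and there are N
    (N - 1) pairs.\<close>
  define \<alpha> where "\<alpha> = (real K - 1) / (N * (N - 1))"
  define F where "F s = (\<Sum>u\<in>B. e u (s u)) / N + \<alpha> * (\<Sum>u\<in>B. \<Sum>v\<in>B. c' u (s u) v (s v))" for s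
  have ie: "integrable (measure_pmf \<Sigma>) (\<lambda>s. e u (s u))" for u
    by (rule measure_pmf.integrable_const_bound[where B=1]) (use e in auto)
  have ic: "integrable (measure_pmf \<Sigma>) (\<lambda>s. c' u (s u) v (s v))" for u v
    by (rule measure_pmf.integrable_const_bound[where B=1]) (use c in \<open>auto simp: c'_def\<close>)
  have iF: "integrable (measure_pmf \<Sigma>) F"
    unfolding F_def by (intro Bochner_Integration.integrable_add integrable_divide_zero
        Bochner_Integration.integrable_mult_right Bochner_Integration.integrable_sum) (auto intro: ie ic)
  have Ee: "measure_pmf.expectation \<Sigma> (\<lambda>s. e u (s u)) = measure_pmf.expectation \<sigma> (e u)" if "u \<in> B" for u
  proof -
    have "measure_pmf.expectation (map_pmf (\<lambda>s. s u) \<Sigma>) (e u) = measure_pmf.expectation \<sigma> (e u)"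
      unfolding \<Sigma>_def by (subst Pi_pmf_component[OF B]) (use that in auto)
    then show ?thesis by simp
  qed
  have Ec: "measure_pmf.expectation \<Sigma> (\<lambda>s. c' u (s u) v (s v)) \<le>
      measure_pmf.expectation (pair_pmf \<sigma> \<sigma>) (\<lambda>(s, t). c u s v t)" if "u \<in> B" "v \<in> B" for u v
  proof (cases "u = v")
    case True
    then show ?thesis by (auto simp: c'_def c intro!: integral_nonneg_AE)
  next
    case False
    have "measure_pmf.expectation (map_pmf (\<lambda>s. (s u, s v)) \<Sigma>) (\<lambda>(s, t). c u s v t) =
       measure_pmf.expectation (pair_pmf \<sigma> \<sigma>) (\<lambda>(s, t). c u s v t)"
      unfolding \<Sigma>_def by (subst map_Pi_pmf_pair[OF B that False]) simp
    then show ?thesis using False by (simp add: c'_def)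
  qed
  obtain s where s: "s \<in> set_pmf \<Sigma>" "F s \<le> measure_pmf.expectation \<Sigma> F"
    using pmf_exists_le_expectation[OF iF] by blast
  have N: "N \<ge> 1" "real K \<le> N" using K by (auto simp: N_def)
  define S where "S = (\<Sum>u\<in>B. \<Sum>v\<in>B. measure_pmf.expectation (pair_pmf \<sigma> \<sigma>) (\<lambda>(s, t). c u s v t))"
  have S0: "S \<ge> 0" unfolding S_def by (intro sum_nonneg integral_nonneg_AE) (auto simp: c)
  have \<alpha>0: "\<alpha> \<ge> 0" using N K by (simp add: \<alpha>_def)
  \<comment> \<open>For N \<ge> 2, N - 1 \<ge> N/2 costs the factor 2; for N = 1 also K = 1, and
    both sides vanish.\<close>
  have \<alpha>: "\<alpha> \<le> 2 * (real K - 1) / N\<^sup>2"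
  proof (cases "card B = 1")
    case True then show ?thesis using K by (simp add: \<alpha>_def N_def)
  next
    case False
    then have "N \<ge> 2" using K by (auto simp: N_def)
    then have "1 / (N * (N - 1)) \<le> 2 / N\<^sup>2"
      by (simp add: field_simps power2_eq_square)
    from mult_left_mono[OF this, of "real K - 1"] show ?thesis using K by (simp add: \<alpha>_def mult_ac)
  qed
  have "measure_pmf.expectation \<Sigma> F = (\<Sum>u\<in>B. measure_pmf.expectation \<Sigma> (\<lambda>s. e u (s u))) / N
      + \<alpha> * (\<Sum>u\<in>B. \<Sum>v\<in>B. measure_pmf.expectation \<Sigma> (\<lambda>s. c' u (s u) v (s v)))"
  proof -
    have "measure_pmf.expectation \<Sigma> (\<lambda>s. \<Sum>u\<in>B. e u (s u)) = (\<Sum>u\<in>B. measure_pmf.expectation \<Sigma> (\<lambda>s. e u (s u)))"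
      by (intro Bochner_Integration.integral_sum ie)
    moreover have "measure_pmf.expectation \<Sigma> (\<lambda>s. \<Sum>u\<in>B. \<Sum>v\<in>B. c' u (s u) v (s v)) =
        (\<Sum>u\<in>B. \<Sum>v\<in>B. measure_pmf.expectation \<Sigma> (\<lambda>s. c' u (s u) v (s v)))"
      by (subst Bochner_Integration.integral_sum)
         (auto intro!: Bochner_Integration.integrable_sum Bochner_Integration.integral_sum ic sum.cong)
    ultimately show ?thesis
      unfolding F_def
      by (subst Bochner_Integration.integral_add)
         (auto intro!: ie ic integrable_divide_zero Bochner_Integration.integrable_sum)
  qed
  also have "\<dots> \<le> (\<Sum>u\<in>B. measure_pmf.expectation \<sigma> (e u)) / N + \<alpha> * S"
    unfolding S_def by (intro add_mono mult_left_mono divide_right_mono sum_mono \<alpha>0 Ec) (use Ee N in auto)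
  also have "\<dots> \<le> (\<Sum>u\<in>B. measure_pmf.expectation \<sigma> (e u)) / N + 2 * (real K - 1) / N\<^sup>2 * S"
    using \<alpha> S0 by (intro add_left_mono mult_right_mono) auto
  finally have F: "F s \<le> (\<Sum>u\<in>B. measure_pmf.expectation \<sigma> (e u)) / N + 2 * (real K - 1) * S / N\<^sup>2"
    using s(2) by simp
  obtain T where T: "T \<subseteq> B" "card T = K" "(\<Sum>u\<in>T. e u (s u)) / K +
     (real K - 1) * (\<Sum>u\<in>T. \<Sum>v\<in>T. c' u (s u) v (s v)) / (K * (real K - 1)) \<le> F s"
    using exists_subset_le_average[OF B K, where e="\<lambda>u. e u (s u)" and c="\<lambda>u v. c' u (s u) v (s v)"]
    unfolding F_def \<alpha>_def N_def by (auto simp: c'_def)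
  have finT: "finite T" using T B finite_subset by blast
  have "(\<Sum>u\<in>T. \<Sum>v\<in>T. c' u (s u) v (s v)) = (\<Sum>u\<in>T. \<Sum>v\<in>T-{u}. c u (s u) v (s v))"
    by (intro sum.cong refl sum.mono_neutral_cong_right) (use finT in \<open>auto simp: c'_def\<close>)
  \<comment> \<open>At K = 1 the quotient with denominator K - 1 is 0 by convention, so the
    competitor sum must be checked separately: \<open>T\<close> is a singleton and the sum is
    empty.\<close>
  moreover have "(\<Sum>u\<in>T. \<Sum>v\<in>T-{u}. c u (s u) v (s v)) = 0" if "K = 1"
  proof -
    have "card T = 1" using T(2) that by simp
    then obtain t where "T = {t}" by (rule card_1_singletonE)
    then show ?thesis by simp
  qed
  ultimately have "(\<Sum>u\<in>T. e u (s u) + (\<Sum>v\<in>T-{u}. c u (s u) v (s v))) / K =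
     (\<Sum>u\<in>T. e u (s u)) / K + (real K - 1) * (\<Sum>u\<in>T. \<Sum>v\<in>T. c' u (s u) v (s v)) / (K * (real K - 1))"
    using K unfolding sum.distrib add_divide_distrib by (cases "K = 1") simp_all
  then have "(\<Sum>u\<in>T. e u (s u) + (\<Sum>v\<in>T-{u}. c u (s u) v (s v))) / K \<le> F s"
    using T(3) by simp
  then have "(\<Sum>u\<in>T. e u (s u) + (\<Sum>v\<in>T-{u}. c u (s u) v (s v))) / K \<le> 
     (\<Sum>u\<in>B. measure_pmf.expectation \<sigma> (e u)) / N + 2 * (real K - 1) * S / N\<^sup>2" using F by simp
  moreover have "\<forall>u\<in>B. s u \<in> set_pmf \<sigma>"
    using s(1) B by (auto simp: \<Sigma>_def set_Pi_pmf PiE_dflt_def)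
  ultimately show ?thesis using T(1,2) unfolding S_def N_def by (intro exI[of _ T] exI[of _ s]) simp
qed

section \<open>Size and confusion probability of the B-typical set\<close>

lemma finite_amplitudes: "finite (amplitudes M)"
proof -
  have "amplitudes M = (\<lambda>k. 2 * int k + 1) ` {..<M div 2}" by (auto simp: amplitudes_def)
  then show ?thesis by simp
qed

lemma finite_B_typical: "finite (B_typical M n \<epsilon> p W)"
  by (rule finite_subset[of _ "{..<n} \<rightarrow>\<^sub>E amplitudes M"])
     (auto simp: B_typical_def intro!: finite_PiE finite_amplitudes)

lemma B_typicalD:
  assumes "a \<in> B_typical M n \<epsilon> p W"
  shows "typical n \<epsilon> p a" and "i \<ge> n \<Longrightarrow> a i = undefined"
    and "measure_pmf.prob (Pi_pmf {..<n} undefined (\<lambda>i. sign_output W (a i)))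
          {v. \<not> jointly_typical3 n \<epsilon> (joint_pmf p W) a (\<lambda>i. fst (v i)) (\<lambda>i. snd (v i))} \<le> \<epsilon>"
proof -
  have *: "a \<in> {..<n} \<rightarrow>\<^sub>E amplitudes M" "typical n \<epsilon> p a"
    "measure_pmf.prob (Pi_pmf {..<n} undefined (\<lambda>i. sign_output W (a i)))
       {v. jointly_typical3 n \<epsilon> (joint_pmf p W) a (\<lambda>i. fst (v i)) (\<lambda>i. snd (v i))} \<ge> 1 - \<epsilon>"
    using assms unfolding B_typical_def mem_Collect_eq by blast+
  show "typical n \<epsilon> p a" by fact
  show "i \<ge> n \<Longrightarrow> a i = undefined" using *(1) by (auto simp: PiE_def extensional_def)
  show "measure_pmf.prob (Pi_pmf {..<n} undefined (\<lambda>i. sign_output W (a i)))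
          {v. \<not> jointly_typical3 n \<epsilon> (joint_pmf p W) a (\<lambda>i. fst (v i)) (\<lambda>i. snd (v i))} \<le> \<epsilon>"
    using *(3) measure_pmf.prob_compl[of "{v. jointly_typical3 n \<epsilon> (joint_pmf p W) a (\<lambda>i. fst (v i)) (\<lambda>i. snd (v i))}"
      "Pi_pmf {..<n} undefined (\<lambda>i. sign_output W (a i))"]
    by (simp add: Compl_eq_Diff_UNIV[symmetric] Collect_neg_eq)
qed

lemma pmf_iid_B_typical:
  assumes "a \<in> B_typical M n \<epsilon> p W" "n > 0"
  shows "2 powr (- (real n * (pmf_entropy p + \<epsilon>))) \<le> pmf (iid_pmf n p) a"
    and "pmf (iid_pmf n p) a \<le> 2 powr (- (real n * (pmf_entropy p - \<epsilon>)))"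
proof -
  have "pmf (iid_pmf n p) a = (\<Prod>i<n. pmf p (a i))"
    using B_typicalD(2)[OF assms(1)] by (subst pmf_Pi') auto
  then show "2 powr (- (real n * (pmf_entropy p + \<epsilon>))) \<le> pmf (iid_pmf n p) a"
    "pmf (iid_pmf n p) a \<le> 2 powr (- (real n * (pmf_entropy p - \<epsilon>)))"
    using typical_prod_bounds[OF B_typicalD(1)[OF assms(1)] assms(2)] by simp_all
qed

lemma map_joint_pmf_amplitude: "map_pmf (\<lambda>(a, s, y). a) (joint_pmf p W) = p"
  by (simp add: joint_pmf_def sign_output_def map_pmf_def bind_assoc_pmf bind_return_pmf bind_return_pmf')

text \<open>A Markov argument: every amplitude sequence outside \<open>B_typical\<close> fails
  conditionally with probability at least \<epsilon>, so a total failure probability of \<epsilon>/2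
  leaves the set probability at least 1/2. Each member has probability at most 2^(-n (H(A) -
  \<epsilon>)), which bounds the number of members from below.\<close>

lemma card_B_typical_ge:
  assumes p: "set_pmf p \<subseteq> amplitudes M" and \<epsilon>: "0 < \<epsilon>" "\<epsilon> < 1" and n: "n > 0"
    and nt: "measure_pmf.prob (iid_pmf n (joint_pmf p W))
      {z. \<not> jointly_typical3 n \<epsilon> (joint_pmf p W) (\<lambda>i. fst (z i)) (\<lambda>i. fst (snd (z i))) (\<lambda>i. snd (snd (z i)))} \<le> \<epsilon> / 2"
  shows "1 / 2 * 2 powr (real n * (pmf_entropy p - \<epsilon>)) \<le> real (card (B_typical M n \<epsilon> p W))"
proof -
  let ?J = "joint_pmf p W" and ?P = "iid_pmf n p" and ?B = "B_typical M n \<epsilon> p W"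
  let ?V = "\<lambda>a. Pi_pmf {..<n} undefined (\<lambda>i. sign_output W (a i))"
  let ?NT = "\<lambda>a. {v. \<not> jointly_typical3 n \<epsilon> ?J a (\<lambda>i. fst (v i)) (\<lambda>i. snd (v i))}"
  let ?N = "{z. \<not> jointly_typical3 n \<epsilon> ?J (\<lambda>i. fst (z i)) (\<lambda>i. fst (snd (z i))) (\<lambda>i. snd (snd (z i)))}"
  have eq: "measure_pmf.prob (iid_pmf n ?J) ?N = measure_pmf.expectation ?P (\<lambda>a. measure_pmf.prob (?V a) (?NT a))"
  proof -
    have "jointly_typical3 n \<epsilon> ?J (\<lambda>i. fst (if i \<in> {..<n} then (a i, v i) else undefined))
         (\<lambda>i. fst (snd (if i \<in> {..<n} then (a i, v i) else undefined)))
         (\<lambda>i. snd (snd (if i \<in> {..<n} then (a i, v i) else undefined))) \<longleftrightarrow>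
       jointly_typical3 n \<epsilon> ?J a (\<lambda>i. fst (v i)) (\<lambda>i. snd (v i))" for a v
      by (rule jointly_typical3_cong) auto
    then show ?thesis
      unfolding iid_joint_pmf prob_bind_pmf map_pmf_def[symmetric] measure_map_pmf by (simp add: vimage_def)
  qed
  \<comment> \<open>If the amplitude sequence itself is not typical, no sign-output pair can repair
    it and the failure probability is 1; otherwise it is the conditional probability in the
    definition that is too small.\<close>
  have low: "measure_pmf.prob (?V a) (?NT a) \<ge> \<epsilon>" if a: "a \<in> set_pmf ?P" "a \<notin> ?B" for a
  proof (cases "typical n \<epsilon> p a")
    case False
    then have "?NT a = UNIV"
      by (auto simp: jointly_typical3_def map_joint_pmf_amplitude)
    then show ?thesis using \<epsilon> by simp
  next
    case True
    have "a \<in> {..<n} \<rightarrow>\<^sub>E amplitudes M"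
      using a(1) p by (auto simp: set_Pi_pmf PiE_dflt_def PiE_def extensional_def)
    then have "\<not> measure_pmf.prob (?V a) {v. jointly_typical3 n \<epsilon> ?J a (\<lambda>i. fst (v i)) (\<lambda>i. snd (v i))} \<ge> 1 - \<epsilon>"
      using True a(2) unfolding B_typical_def mem_Collect_eq by blast
    then show ?thesis
      using measure_pmf.prob_compl[of "{v. jointly_typical3 n \<epsilon> ?J a (\<lambda>i. fst (v i)) (\<lambda>i. snd (v i))}" "?V a"]
      by (simp add: Compl_eq_Diff_UNIV[symmetric] Collect_neg_eq)
  qed
  have "\<epsilon> * measure_pmf.prob ?P (- ?B) = measure_pmf.expectation ?P (\<lambda>a. \<epsilon> * indicator (- ?B) a)"
    by simp
  also have "\<dots> \<le> measure_pmf.expectation ?P (\<lambda>a. measure_pmf.prob (?V a) (?NT a))"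
  proof (rule integral_mono_AE)
    show "AE a in measure_pmf ?P. \<epsilon> * indicator (- ?B) a \<le> measure_pmf.prob (?V a) (?NT a)"
      by (rule AE_pmfI) (use low in \<open>auto simp: indicator_def\<close>)
  qed (auto intro!: measure_pmf.integrable_const_bound[where B=1] simp: indicator_def \<epsilon> less_imp_le)
  also have "\<dots> \<le> \<epsilon> / 2" using nt eq by simp
  finally have "measure_pmf.prob ?P (- ?B) \<le> 1 / 2" using \<epsilon> by simp
  then have "1 / 2 \<le> measure_pmf.prob ?P ?B"
    using measure_pmf.prob_compl[of ?B ?P] by (simp add: Compl_eq_Diff_UNIV)
  also have "\<dots> = (\<Sum>a\<in>?B. pmf ?P a)"
    by (rule measure_measure_pmf_finite[OF finite_B_typical])
  also have "\<dots> \<le> (\<Sum>a\<in>?B. 2 powr (- (real n * (pmf_entropy p - \<epsilon>))))"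
    by (intro sum_mono pmf_iid_B_typical n)
  also have "\<dots> = card ?B * 2 powr (- (real n * (pmf_entropy p - \<epsilon>)))" by simp
  also have "\<dots> = card ?B / 2 powr (real n * (pmf_entropy p - \<epsilon>))"
    unfolding powr_minus divide_inverse ..
  finally show ?thesis by (subst (asm) pos_le_divide_eq) simp_all
qed

text \<open>The conditional probability defining \<open>B_typical\<close> already averages over
  uniform signs, so this is the defining bound of the set, rewritten for a random sign
  sequence.\<close>

lemma expectation_sign_error_le:
  assumes "a \<in> B_typical M n \<epsilon> p W"
  shows "measure_pmf.expectation (iid_pmf n (pmf_of_set signs)) (\<lambda>s.
      measure_pmf.prob (memoryless_output n W (\<lambda>i. a i * s i)) {y. \<not> jointly_typical3 n \<epsilon> (joint_pmf p W) a s y}) \<le> \<epsilon>"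
proof -
  let ?J = "joint_pmf p W"
  have "jointly_typical3 n \<epsilon> ?J a (\<lambda>i. fst (if i \<in> {..<n} then (s i, y i) else undefined))
         (\<lambda>i. snd (if i \<in> {..<n} then (s i, y i) else undefined)) \<longleftrightarrow>
       jointly_typical3 n \<epsilon> ?J a s y" for s y
    by (rule jointly_typical3_cong) auto
  then show ?thesis
    using B_typicalD(3)[OF assms]
    unfolding Pi_pmf_sign_output prob_bind_pmf map_pmf_def[symmetric] measure_map_pmf by (simp add: vimage_def)
qed

text \<open>The left side is the probability that a uniform member of the set with random signs is
  typical with the output of another, independent one. Passing from the uniform to the i.i.d.
  amplitude law costs a factor \<open>C\<close> for each of the two, and C^2 = 4 * 2^(4 n
  \<epsilon>) turns 3 \<epsilon> into 7 \<epsilon>.\<close>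

lemma average_confusion_le:
  fixes W :: "int \<Rightarrow> 'y::countable pmf" and n :: nat
  defines "\<sigma> \<equiv> iid_pmf n (pmf_of_set signs)"
  assumes fin: "finite_entropy_pmf (joint_pmf p W)" and n: "n > 0"
    and card: "1 / 2 * 2 powr (real n * (pmf_entropy p - \<epsilon>)) \<le> real (card (B_typical M n \<epsilon> p W))"
  shows "(\<Sum>u\<in>B_typical M n \<epsilon> p W. \<Sum>v\<in>B_typical M n \<epsilon> p W. measure_pmf.expectation (pair_pmf \<sigma> \<sigma>) (\<lambda>(s, t).
      measure_pmf.prob (memoryless_output n W (\<lambda>i. u i * s i)) {y. jointly_typical3 n \<epsilon> (joint_pmf p W) v t y}))
      / (real (card (B_typical M n \<epsilon> p W)))\<^sup>2
    \<le> 4 * 2 powr (- (real n * (mutual_info_SA_Y p W - 7 * \<epsilon>)))"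
proof -
  let ?J = "joint_pmf p W" and ?P = "iid_pmf n p"
  define B where "B = B_typical M n \<epsilon> p W"
  define N where "N = real (card B)"
  \<comment> \<open>Ratio of the largest possible uniform mass, 2 * 2^(-n (H(A) - \<epsilon>)), to
    the smallest i.i.d. mass of a member, 2^(-n (H(A) + \<epsilon>)).\<close>
  define C where "C = 2 * 2 powr (real n * (2 * \<epsilon>))"
  define Wn where "Wn u s = memoryless_output n W (\<lambda>i. u i * s i)" for u s :: "nat \<Rightarrow> int"
  define T where "T = {(v, t, y). jointly_typical3 n \<epsilon> ?J v t y}"
  have N: "1 / 2 * 2 powr (real n * (pmf_entropy p - \<epsilon>)) \<le> N" using card by (simp add: N_def B_def)
  have Npos: "N > 0" by (rule less_le_trans[OF _ N]) simp
  then have finB: "finite B" "B \<noteq> {}" by (auto simp: N_def card_gt_0_iff)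
  define U where "U = pmf_of_set B"
  \<comment> \<open>Both amplitude sequences are drawn from \<open>q\<close>: \<open>y\<close>
    responds to \<open>u\<close> with signs \<open>s\<close>, while \<open>v\<close> and
    \<open>t\<close> belong to the competitor.\<close>
  define X where "X q = do { u \<leftarrow> q; s \<leftarrow> \<sigma>; y \<leftarrow> Wn u s; v \<leftarrow> q; t \<leftarrow> \<sigma>; return_pmf (v, t, y) }" for q
  have dom: "pmf U u \<le> C * pmf ?P u" for u
  proof (cases "u \<in> B")
    case True
    have "1 / N \<le> 1 / (1 / 2 * 2 powr (real n * (pmf_entropy p - \<epsilon>)))"
      by (rule divide_left_mono[OF N]) (use Npos in auto)
    also have "\<dots> = 2 * 2 powr (- (real n * (pmf_entropy p - \<epsilon>)))"
      unfolding powr_minus by (simp add: field_simps)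
    also have "- (real n * (pmf_entropy p - \<epsilon>)) = real n * (2 * \<epsilon>) + - (real n * (pmf_entropy p + \<epsilon>))"
      by (simp add: algebra_simps)
    also have "2 * 2 powr \<dots> = C * 2 powr (- (real n * (pmf_entropy p + \<epsilon>)))"
      unfolding C_def powr_add by simp
    also have "\<dots> \<le> C * pmf ?P u"
      using pmf_iid_B_typical(1)[OF True[unfolded B_def] n] by (intro mult_left_mono) (auto simp: C_def)
    finally show ?thesis using True finB by (simp add: U_def N_def)
  next
    case False
    then show ?thesis using finB by (simp add: U_def C_def)
  qed
  have C0: "C \<ge> 0" by (simp add: C_def)
  have dom': "nn_integral (measure_pmf U) f \<le> ennreal C * nn_integral (measure_pmf ?P) f" for f
    by (rule nn_integral_pmf_le) (use dom C0 in auto)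
  have "(\<Sum>u\<in>B. \<Sum>v\<in>B. measure_pmf.expectation (pair_pmf \<sigma> \<sigma>) (\<lambda>(s, t).
      measure_pmf.prob (Wn u s) {y. jointly_typical3 n \<epsilon> ?J v t y})) / N\<^sup>2
     = measure_pmf.prob (X U) T"
  proof -
    \<comment> \<open>Drawing \<open>v\<close> right after \<open>u\<close> exposes the double sum
      over \<open>B\<close>.\<close>
    have "X U = do { u \<leftarrow> U; v \<leftarrow> U; (s, t) \<leftarrow> pair_pmf \<sigma> \<sigma>; y \<leftarrow> Wn u s; return_pmf (v, t, y) }"
    proof -
      have "do { s \<leftarrow> \<sigma>; y \<leftarrow> Wn u s; v \<leftarrow> U; t \<leftarrow> \<sigma>; return_pmf (v, t, y) } =
          do { v \<leftarrow> U; s \<leftarrow> \<sigma>; t \<leftarrow> \<sigma>; y \<leftarrow> Wn u s; return_pmf (v, t, y) }" for u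
        unfolding bind_commute_pmf[of U \<sigma>] bind_commute_pmf[of \<sigma> "Wn u _"] bind_commute_pmf[of U "Wn u _"] ..
      then show ?thesis
        unfolding X_def pair_pmf_def bind_assoc_pmf bind_return_pmf case_prod_conv by simp
    qed
    also have "measure_pmf.prob \<dots> T = (\<Sum>u\<in>B. (\<Sum>v\<in>B. measure_pmf.expectation (pair_pmf \<sigma> \<sigma>) (\<lambda>(s, t).
      measure_pmf.prob (Wn u s) {y. jointly_typical3 n \<epsilon> ?J v t y})) / N) / N"
      unfolding prob_bind_pmf case_prod_beta' map_pmf_def[symmetric] measure_map_pmf
      using finB by (simp add: U_def integral_pmf_of_set N_def vimage_def T_def sum_divide_distrib[symmetric])
    finally show ?thesis
      by (simp add: power2_eq_square sum_divide_distrib[symmetric])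
  qed
  also have "ennreal (measure_pmf.prob (X U) T) \<le> ennreal (C\<^sup>2 * measure_pmf.prob (X ?P) T)"
  proof -
    have "emeasure (X U) T = (\<integral>\<^sup>+u. \<integral>\<^sup>+s. \<integral>\<^sup>+y. \<integral>\<^sup>+v. \<integral>\<^sup>+t. indicator T (v, t, y) \<partial>\<sigma> \<partial>U \<partial>Wn u s \<partial>\<sigma> \<partial>U)"
      by (simp add: X_def)
    \<comment> \<open>As iterated integrals, the experiment allows the domination to be applied
      first to the competitor \<open>v\<close>, then to the transmitted \<open>u\<close>.\<close>
    also have "\<dots> \<le> (\<integral>\<^sup>+u. \<integral>\<^sup>+s. \<integral>\<^sup>+y. ennreal C * (\<integral>\<^sup>+v. \<integral>\<^sup>+t. indicator T (v, t, y) \<partial>\<sigma> \<partial>?P) \<partial>Wn u s \<partial>\<sigma> \<partial>U)"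
      by (intro nn_integral_mono dom')
    also have "\<dots> = ennreal C * (\<integral>\<^sup>+u. \<integral>\<^sup>+s. \<integral>\<^sup>+y. (\<integral>\<^sup>+v. \<integral>\<^sup>+t. indicator T (v, t, y) \<partial>\<sigma> \<partial>?P) \<partial>Wn u s \<partial>\<sigma> \<partial>U)"
      by (simp add: nn_integral_cmult)
    also have "\<dots> \<le> ennreal C * (ennreal C * (\<integral>\<^sup>+u. \<integral>\<^sup>+s. \<integral>\<^sup>+y. (\<integral>\<^sup>+v. \<integral>\<^sup>+t. indicator T (v, t, y) \<partial>\<sigma> \<partial>?P) \<partial>Wn u s \<partial>\<sigma> \<partial>?P))"
      by (intro mult_left_mono dom') auto
    also have "(\<integral>\<^sup>+u. \<integral>\<^sup>+s. \<integral>\<^sup>+y. (\<integral>\<^sup>+v. \<integral>\<^sup>+t. indicator T (v, t, y) \<partial>\<sigma> \<partial>?P) \<partial>Wn u s \<partial>\<sigma> \<partial>?P) = emeasure (X ?P) T"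
      by (simp add: X_def)
    finally show ?thesis
      using C0 by (simp add: measure_pmf.emeasure_eq_measure ennreal_mult power2_eq_square mult.assoc)
  qed
  then have "measure_pmf.prob (X U) T \<le> C\<^sup>2 * measure_pmf.prob (X ?P) T"
    using C0 by (subst (asm) ennreal_le_iff) auto
  also have "measure_pmf.prob (X ?P) T = measure_pmf.prob (iid_pmf n (indep_joint_pmf p W))
     {z. jointly_typical3 n \<epsilon> ?J (\<lambda>i. fst (z i)) (\<lambda>i. fst (snd (z i))) (\<lambda>i. snd (snd (z i)))}"
  proof -
    have "jointly_typical3 n \<epsilon> ?J (\<lambda>i. fst (if i \<in> {..<n} then (v i, t i, y i) else undefined))
         (\<lambda>i. fst (snd (if i \<in> {..<n} then (v i, t i, y i) else undefined)))
         (\<lambda>i. snd (snd (if i \<in> {..<n} then (v i, t i, y i) else undefined))) \<longleftrightarrow>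
       jointly_typical3 n \<epsilon> ?J v t y" for v t y
      by (rule jointly_typical3_cong) auto
    then show ?thesis
      unfolding iid_indep_joint_pmf X_def Wn_def \<sigma>_def prob_bind_pmf map_pmf_def[symmetric] measure_map_pmf
      by (simp add: vimage_def T_def)
  qed
  also have "C\<^sup>2 * \<dots> \<le> C\<^sup>2 * 2 powr (- (real n * (mutual_info_SA_Y p W - 3 * \<epsilon>)))"
    by (intro mult_left_mono prob_indep_typical_le[OF fin n]) auto
  also have "\<dots> = 4 * 2 powr (- (real n * (mutual_info_SA_Y p W - 7 * \<epsilon>)))"
    unfolding C_def power2_eq_square by (simp add: powr_add[symmetric] algebra_simps)
  finally show ?thesis unfolding B_def N_def Wn_def .
qed

section \<open>Decoding error and achievability\<close>

text \<open>Union bound: if the transmitted codeword is typical with the output and no other one is,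
  the unique index exists and is correct.\<close>

lemma smd_error_prob_le:
  assumes Ma: "Ma \<ge> 1"
  shows "smd_error_prob W n p \<epsilon> Ma a s \<le>
    (\<Sum>k\<in>{1..Ma}. measure_pmf.prob (memoryless_output n W (\<lambda>i. a k i * s k i))
          {y. \<not> jointly_typical3 n \<epsilon> (joint_pmf p W) (a k) (s k) y} +
       (\<Sum>l\<in>{1..Ma}-{k}. measure_pmf.prob (memoryless_output n W (\<lambda>i. a k i * s k i))
          {y. jointly_typical3 n \<epsilon> (joint_pmf p W) (a l) (s l) y})) / Ma"
proof -
  let ?T = "\<lambda>k y. jointly_typical3 n \<epsilon> (joint_pmf p W) (a k) (s k) y"
  let ?W = "\<lambda>k. memoryless_output n W (\<lambda>i. a k i * s k i)"
  let ?D = "smd_decode W n p \<epsilon> Ma a s"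
  have eq: "smd_error_prob W n p \<epsilon> Ma a s = (\<Sum>k\<in>{1..Ma}. measure_pmf.prob (?W k) {y. ?D y \<noteq> Some k}) / Ma"
    unfolding smd_error_prob_def prob_bind_pmf map_pmf_def[symmetric] measure_map_pmf
    using Ma by (simp add: integral_pmf_of_set vimage_def)
  have "measure_pmf.prob (?W k) {y. ?D y \<noteq> Some k} \<le>
      measure_pmf.prob (?W k) {y. \<not> ?T k y} + (\<Sum>l\<in>{1..Ma}-{k}. measure_pmf.prob (?W k) {y. ?T l y})"
    if k: "k \<in> {1..Ma}" for k
  proof -
    have sub: "{y. ?D y \<noteq> Some k} \<subseteq> {y. \<not> ?T k y} \<union> (\<Union>l\<in>{1..Ma}-{k}. {y. ?T l y})"
    proof (rule subsetI, rule ccontr)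
      fix y assume y: "y \<in> {y. ?D y \<noteq> Some k}" and n: "y \<notin> {y. \<not> ?T k y} \<union> (\<Union>l\<in>{1..Ma}-{k}. {y. ?T l y})"
      define ok where "ok l \<longleftrightarrow> l \<in> {1..Ma} \<and> ?T l y" for l
      have ok: "ok k" "\<And>l. ok l \<Longrightarrow> l = k" using k n unfolding ok_def by blast+
      then have "\<exists>!l. ok l" by blast
      moreover have "(THE l. ok l) = k" using ok by (intro the_equality)
      moreover have "?D y = (if \<exists>!l. ok l then Some (THE l. ok l) else None)"
        unfolding smd_decode_def Let_def ok_def ..
      ultimately have "?D y = Some k" by simp
      then show False using y by simp
    qed
    have "measure_pmf.prob (?W k) {y. ?D y \<noteq> Some k} \<le>
        measure_pmf.prob (?W k) ({y. \<not> ?T k y} \<union> (\<Union>l\<in>{1..Ma}-{k}. {y. ?T l y}))"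
      by (rule measure_pmf.finite_measure_mono[OF sub]) simp
    also have "\<dots> \<le> measure_pmf.prob (?W k) {y. \<not> ?T k y} + measure_pmf.prob (?W k) (\<Union>l\<in>{1..Ma}-{k}. {y. ?T l y})"
      by (rule measure_Un_le) auto
    also have "\<dots> \<le> measure_pmf.prob (?W k) {y. \<not> ?T k y} + (\<Sum>l\<in>{1..Ma}-{k}. measure_pmf.prob (?W k) {y. ?T l y})"
      by (intro add_left_mono measure_UNION_le) auto
    finally show ?thesis .
  qed
  then show ?thesis unfolding eq by (intro divide_right_mono sum_mono) auto
qed

lemma achievable_smd_entropy:
  fixes W :: "int \<Rightarrow> 'y::countable pmf"
  assumes p: "set_pmf p \<subseteq> amplitudes M" and fin: "finite_entropy_pmf (joint_pmf p W)"
    and HI: "pmf_entropy p \<le> mutual_info_SA_Y p W"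
  shows "achievable_smd M W (pmf_entropy p)"
  unfolding achievable_smd_def
proof (intro allI impI)
  fix \<delta> :: real assume \<delta>: "\<delta> > 0"
  \<comment> \<open>7 \<epsilon> \<le> \<delta>/2 leaves a decay exponent of \<delta>/2 in the
    confusion term, and \<epsilon> \<le> \<delta>/2 covers the failure of the transmitted codeword;
    the 1/4 keeps \<epsilon> below 1.\<close>
  define \<epsilon> where "\<epsilon> = min (1/4) (\<delta>/14)"
  have \<epsilon>: "0 < \<epsilon>" "\<epsilon> < 1" "14 * \<epsilon> \<le> \<delta>" using \<delta> by (auto simp: \<epsilon>_def)
  define H where "H = pmf_entropy p"
  define I where "I = mutual_info_SA_Y p W"
  let ?J = "joint_pmf p W"
  let ?N = "\<lambda>n. {z. \<not> jointly_typical3 n \<epsilon> ?J (\<lambda>i. fst (z i)) (\<lambda>i. fst (snd (z i))) (\<lambda>i. snd (snd (z i)))}"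
  \<comment> \<open>Three conditions on the block length: \<open>ev1\<close> makes the B-typical set
    large, \<open>ev2\<close> makes the codebook fit into it, \<open>ev3\<close> makes confusion
    rare.\<close>
  have ev1: "\<forall>\<^sub>F n in sequentially. measure_pmf.prob (iid_pmf n ?J) (?N n) < \<epsilon> / 2"
    by (rule order_tendstoD(2)[OF tendsto_prob_jointly_typical[OF fin \<epsilon>(1)]]) (use \<epsilon> in auto)
  have ev2: "\<forall>\<^sub>F n in sequentially. real n * (\<delta> - \<epsilon>) \<ge> 1"
  proof -
    have "\<delta> - \<epsilon> > 0" using \<epsilon> by simp
    then have "filterlim (\<lambda>n. real n * (\<delta> - \<epsilon>)) at_top sequentially"
      by (intro filterlim_at_top_mult_tendsto_pos[OF tendsto_const _ filterlim_real_sequentially])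
    then show ?thesis by (simp add: filterlim_at_top)
  qed
  have ev3: "\<forall>\<^sub>F n in sequentially. 8 * 2 powr (- (real n * (\<delta> / 2))) < \<delta> / 2"
  proof -
    have "filterlim (\<lambda>n. real n * (\<delta> / 2 * ln 2)) at_top sequentially"
      using \<delta> by (intro filterlim_at_top_mult_tendsto_pos[OF tendsto_const _ filterlim_real_sequentially]) auto
    then have "filterlim (\<lambda>n. - (real n * (\<delta> / 2 * ln 2))) at_bot sequentially"
      by (simp add: filterlim_uminus_at_bot)
    then have "(\<lambda>n. exp (- (real n * (\<delta> / 2 * ln 2)))) \<longlonglongrightarrow> 0"
      by (rule filterlim_compose[OF exp_at_bot])
    then have "(\<lambda>n. 8 * 2 powr (- (real n * (\<delta> / 2)))) \<longlonglongrightarrow> 8 * 0"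
      by (intro tendsto_mult tendsto_const) (simp add: powr_def mult_ac)
    from order_tendstoD(2)[OF this, of "\<delta> / 2"] show ?thesis using \<delta> by simp
  qed
  show "\<forall>\<^sub>F n in sequentially. \<exists>p' \<epsilon> Ma a s. basic_sign_encoder M W n p' \<epsilon> Ma a s \<and>
       (1 / real n) * log 2 (real Ma) \<ge> pmf_entropy p - \<delta> \<and> smd_error_prob W n p' \<epsilon> Ma a s \<le> \<delta>"
    using ev1 ev2 ev3 eventually_gt_at_top[of 0]
  proof eventually_elim
    case (elim n)
    define B where "B = B_typical M n \<epsilon> p W"
    define \<sigma> where "\<sigma> = iid_pmf n (pmf_of_set signs)"
    define e where "e u s = measure_pmf.prob (memoryless_output n W (\<lambda>i. u i * s i)) {y. \<not> jointly_typical3 n \<epsilon> ?J u s y}"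
      for u s :: "nat \<Rightarrow> int"
    define c where "c u s v t = measure_pmf.prob (memoryless_output n W (\<lambda>i. u i * s i)) {y. jointly_typical3 n \<epsilon> ?J v t y}"
      for u s v t :: "nat \<Rightarrow> int"
    define S where "S = (\<Sum>u\<in>B. \<Sum>v\<in>B. measure_pmf.expectation (pair_pmf \<sigma> \<sigma>) (\<lambda>(s, t). c u s v t))"
    have cardB: "1 / 2 * 2 powr (real n * (H - \<epsilon>)) \<le> real (card B)"
      unfolding H_def B_def by (rule card_B_typical_ge[OF p \<epsilon>(1,2) elim(4)]) (use elim(1) in simp)
    have finB: "finite B" by (simp add: B_def finite_B_typical)
    \<comment> \<open>Rounding up secures the rate, while the number K - 1 of competitors is still
      at most 2^(n (H(A) - \<delta>)).\<close>
    define K where "K = nat \<lceil>2 powr (real n * (H - \<delta>))\<rceil>"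
    have K1: "1 \<le> K" by (simp add: K_def Suc_le_eq)
    have K_ge: "2 powr (real n * (H - \<delta>)) \<le> real K" by (simp add: K_def real_nat_ceiling_ge)
    have K_le: "real K - 1 \<le> 2 powr (real n * (H - \<delta>))"
    proof -
      have "real K = of_int \<lceil>2 powr (real n * (H - \<delta>))\<rceil>"
        unfolding K_def by (intro of_nat_nat) (simp add: less_trans[of "-1" 0])
      then show ?thesis by linarith
    qed
    \<comment> \<open>n (\<delta> - \<epsilon>) \<ge> 1 pays for the factor 1/2 in the lower bound
      on \<open>card B\<close>.\<close>
    have KN: "K \<le> card B"
    proof -
      have "2 powr (real n * (H - \<delta>)) = 2 powr (real n * (H - \<epsilon>)) * 2 powr (- (real n * (\<delta> - \<epsilon>)))"
        unfolding powr_add[symmetric] by (simp add: algebra_simps)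
      also have "\<dots> \<le> 2 powr (real n * (H - \<epsilon>)) * 2 powr (-1)"
        using elim(2) by (intro mult_left_mono powr_mono powr_ge_zero) linarith+
      also have "\<dots> = 1 / 2 * 2 powr (real n * (H - \<epsilon>))" by (simp add: powr_minus)
      also have "\<dots> \<le> real (card B)" by (rule cardB)
      finally have "\<lceil>2 powr (real n * (H - \<delta>))\<rceil> \<le> int (card B)" by (simp add: ceiling_le_iff)
      then show ?thesis by (simp only: K_def nat_le_iff)
    qed
    have N0: "real (card B) > 0" using K1 KN by simp
    have ec: "0 \<le> e u s" "e u s \<le> 1" "0 \<le> c u s v t" "c u s v t \<le> 1" for u s v t
      by (auto simp: e_def c_def)
    have "\<exists>T s. T \<subseteq> B \<and> card T = K \<and> (\<forall>u\<in>B. s u \<in> set_pmf \<sigma>) \<and>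
        (\<Sum>u\<in>T. e u (s u) + (\<Sum>v\<in>T-{u}. c u (s u) v (s v))) / K \<le>
        (\<Sum>u\<in>B. measure_pmf.expectation \<sigma> (e u)) / card B + 2 * (real K - 1) * S / (real (card B))\<^sup>2"
      unfolding S_def by (rule random_coding[OF finB K1 KN]) (rule ec)+
    then obtain T s where T: "T \<subseteq> B" "card T = K" and s: "\<And>u. u \<in> B \<Longrightarrow> s u \<in> set_pmf \<sigma>"
      and le: "(\<Sum>u\<in>T. e u (s u) + (\<Sum>v\<in>T-{u}. c u (s u) v (s v))) / K \<le>
        (\<Sum>u\<in>B. measure_pmf.expectation \<sigma> (e u)) / card B + 2 * (real K - 1) * S / (real (card B))\<^sup>2"
      by (elim exE conjE) (rule that; simp)
    have finT: "finite T" using T(1) finB finite_subset by blast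
    obtain h where h: "bij_betw h {1..K} T"
      using ex_bij_betw_nat_finite_1[OF finT] T(2) by auto
    have hT: "h k \<in> T" if "k \<in> {1..K}" for k using h that by (auto simp: bij_betw_def)
    have inj: "inj_on h {1..K}" using h by (simp add: bij_betw_def)
    have "smd_error_prob W n p \<epsilon> K h (\<lambda>k. s (h k)) \<le>
       (\<Sum>k\<in>{1..K}. e (h k) (s (h k)) + (\<Sum>l\<in>{1..K}-{k}. c (h k) (s (h k)) (h l) (s (h l)))) / K"
      using smd_error_prob_le[OF K1, of W n p \<epsilon> h "\<lambda>k. s (h k)"] unfolding e_def c_def .
    also have "\<dots> = (\<Sum>k\<in>{1..K}. e (h k) (s (h k)) + (\<Sum>v\<in>T-{h k}. c (h k) (s (h k)) v (s v))) / K"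
    proof -
      have "(\<Sum>l\<in>{1..K}-{k}. c (h k) (s (h k)) (h l) (s (h l))) = (\<Sum>v\<in>T-{h k}. c (h k) (s (h k)) v (s v))"
        if "k \<in> {1..K}" for k
      proof (rule sum.reindex_bij_betw[where h=h])
        have "h ` ({1..K} - {k}) = T - {h k}"
          using h that inj_on_image_set_diff[OF inj, of "{1..K}" "{k}"] by (auto simp: bij_betw_def)
        then show "bij_betw h ({1..K} - {k}) (T - {h k})"
          using inj_on_subset[OF inj, of "{1..K} - {k}"] by (simp add: bij_betw_def)
      qed
      then show ?thesis by (auto intro!: arg_cong[where f="\<lambda>x. x / real K"] sum.cong)
    qed
    also have "\<dots> = (\<Sum>u\<in>T. e u (s u) + (\<Sum>v\<in>T-{u}. c u (s u) v (s v))) / K"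
      by (intro arg_cong[where f="\<lambda>x. x / real K"] sum.reindex_bij_betw[OF h])
    also note le
    also have "(\<Sum>u\<in>B. measure_pmf.expectation \<sigma> (e u)) / card B \<le> \<epsilon>"
    proof -
      have "(\<Sum>u\<in>B. measure_pmf.expectation \<sigma> (e u)) \<le> (\<Sum>u\<in>B. \<epsilon>)"
        unfolding e_def \<sigma>_def by (intro sum_mono expectation_sign_error_le) (simp add: B_def)
      then show ?thesis using N0 by (simp add: field_simps)
    qed
    \<comment> \<open>Here H(A) \<le> I(SA;Y) enters: the exponent H(A) - \<delta> - (I(SA;Y) - 7
      \<epsilon>) is at most -\<delta> + 7 \<epsilon> \<le> -\<delta>/2, even with equality.\<close>
    also have "2 * (real K - 1) * S / (real (card B))\<^sup>2 \<le> 8 * 2 powr (- (real n * (\<delta> / 2)))"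
    proof -
      have "S / (real (card B))\<^sup>2 \<le> 4 * 2 powr (- (real n * (I - 7 * \<epsilon>)))"
        using average_confusion_le[OF fin elim(4), of \<epsilon> M] cardB
        unfolding S_def B_def \<sigma>_def c_def H_def I_def by simp
      then have "2 * (real K - 1) * (S / (real (card B))\<^sup>2) \<le>
          2 * 2 powr (real n * (H - \<delta>)) * (4 * 2 powr (- (real n * (I - 7 * \<epsilon>))))"
        using K_le K1 by (intro mult_mono) (auto simp: S_def ec case_prod_beta' intro!: divide_nonneg_nonneg sum_nonneg integral_nonneg_AE)
      also have "\<dots> = 8 * 2 powr (real n * (H - \<delta> - (I - 7 * \<epsilon>)))"
        by (simp add: powr_add[symmetric] algebra_simps)
      also have "\<dots> \<le> 8 * 2 powr (real n * (- (\<delta> / 2)))"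
        using HI \<epsilon>(3) by (intro mult_left_mono powr_mono) (auto simp: H_def I_def intro!: mult_left_mono)
      finally show ?thesis by simp
    qed
    finally have err: "smd_error_prob W n p \<epsilon> K h (\<lambda>k. s (h k)) \<le> \<delta>"
      using elim(3) \<epsilon> by simp
    have rate: "(1 / real n) * log 2 (real K) \<ge> H - \<delta>"
    proof -
      have "real n * (H - \<delta>) \<le> log 2 (real K)" using K_ge K1 by (simp add: le_log_iff)
      then show ?thesis using elim(4) by (simp add: field_simps)
    qed
    have sE: "s u \<in> {..<n} \<rightarrow>\<^sub>E signs" if "u \<in> B" for u
      using s[OF that] unfolding \<sigma>_def
      by (auto simp: set_Pi_pmf PiE_dflt_def PiE_def extensional_def signs_def)
    have hB: "h k \<in> B" if "k \<in> {1..K}" for k using hT[OF that] T(1) by blast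
    have "h \<in> {1..K} \<rightarrow> B_typical M n \<epsilon> p W" "(\<lambda>k. s (h k)) \<in> {1..K} \<rightarrow> ({..<n} \<rightarrow>\<^sub>E signs)"
      using hB sE unfolding B_def by blast+
    then have "basic_sign_encoder M W n p \<epsilon> K h (\<lambda>k. s (h k))"
      unfolding basic_sign_encoder_def using p \<epsilon>(1) K1 inj by blast
    then show ?case using rate err unfolding H_def by blast
  qed
qed

section \<open>Existence of the maximum\<close>

lemma continuous_on_xlogx: "continuous_on {0..} (\<lambda>t::real. t * log 2 t)"
proof (rule continuous_on_eq_continuous_within[THEN iffD2], rule ballI)
  fix x :: real assume "x \<in> {0..}"
  show "continuous (at x within {0..}) (\<lambda>t. t * log 2 t)"
  proof (cases "x = 0")
    case True
    have "((\<lambda>t::real. t * ln t) \<longlongrightarrow> 0) (at_right 0)"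
      by real_asymp
    then have "((\<lambda>t::real. t * ln t / ln 2) \<longlongrightarrow> 0 / ln 2) (at_right 0)"
      by (intro tendsto_divide tendsto_const) auto
    then show ?thesis
      using True by (simp add: continuous_within at_within_Ici_at_right log_def)
  next
    case False
    then show ?thesis using \<open>x \<in> {0..}\<close> unfolding continuous_within
      by (intro tendsto_mult tendsto_log tendsto_ident_at tendsto_const) auto
  qed
qed

lemma tendsto_xlogx:
  fixes x :: "nat \<Rightarrow> real"
  assumes "x \<longlonglongrightarrow> l" "\<And>k. x k \<ge> 0"
  shows "(\<lambda>k. x k * log 2 (x k)) \<longlonglongrightarrow> l * log 2 l"
proof -
  have "l \<ge> 0" using LIMSEQ_le_const[OF assms(1)] assms(2) by blast
  then show ?thesis
    by (intro continuous_on_tendsto_compose[OF continuous_on_xlogx assms(1)]) (use assms in auto)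
qed

lemma pmf_entropy_finite:
  fixes p :: "'a::countable pmf"
  assumes "finite A" "set_pmf p \<subseteq> A"
  shows "pmf_entropy p = - (\<Sum>a\<in>A. pmf p a * log 2 (pmf p a))"
  unfolding pmf_entropy_eq using assms
  by (subst integral_measure_pmf[of A]) auto

lemma tendsto_pmf_entropy_finite:
  fixes p :: "'a::countable pmf" and P :: "nat \<Rightarrow> 'a pmf"
  assumes "finite A" "set_pmf p \<subseteq> A" "\<And>k. set_pmf (P k) \<subseteq> A"
    and "\<And>a. (\<lambda>k. pmf (P k) a) \<longlonglongrightarrow> pmf p a"
  shows "(\<lambda>k. pmf_entropy (P k)) \<longlonglongrightarrow> pmf_entropy p"
  unfolding pmf_entropy_finite[OF assms(1,2)] pmf_entropy_finite[OF assms(1,3)]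
  by (intro tendsto_minus tendsto_sum tendsto_xlogx assms) auto

text \<open>Write -t ln t = t ln (K u / t) + t (-ln (K u)). The first term is at most K u by ln x
  \<le> x - 1, the second at most K u (-ln u) because K \<ge> 1. This provides an integrable
  majorant for entropies of mixtures; K = u = 1 gives the uniform bound 1 / ln 2.\<close>

lemma xlogx_bound:
  fixes t u K :: real
  assumes "0 \<le> t" "t \<le> 1" "t \<le> K * u" "0 \<le> u" "u \<le> 1" "K \<ge> 1"
  shows "\<bar>t * log 2 t\<bar> \<le> K * u / ln 2 + K * \<bar>u * log 2 u\<bar>"
proof (cases "t = 0")
  case False
  then have t: "t > 0" and u: "u > 0" using assms by (auto simp: less_le)
  have lu: "ln u \<le> 0" using u assms by simp
  have "t * ln (K * u / t) \<le> t * (K * u / t - 1)"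
    using t u assms by (intro mult_left_mono ln_le_minus_one) auto
  also have "\<dots> \<le> K * u" using t by (simp add: algebra_simps)
  finally have 1: "t * ln (K * u / t) \<le> K * u" .
  have "t * - ln (K * u) \<le> t * - ln u"
    using t u assms by (intro mult_left_mono) auto
  also have "\<dots> \<le> K * u * - ln u"
    using assms lu by (intro mult_right_mono) auto
  finally have 2: "t * - ln (K * u) \<le> K * u * - ln u" .
  have "- (t * ln t) = t * ln (K * u / t) + t * - ln (K * u)"
    using t u assms by (simp add: ln_div algebra_simps)
  then have 3: "- (t * ln t) \<le> K * u + K * (- (u * ln u))" using 1 2 by (simp add: algebra_simps)
  have a: "\<bar>t * log 2 t\<bar> = - (t * ln t) / ln 2" "\<bar>u * log 2 u\<bar> = - (u * ln u) / ln 2"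
    using t u assms by (auto simp: log_def abs_mult abs_divide)
  have "- (t * ln t) / ln 2 \<le> (K * u + K * (- (u * ln u))) / ln 2"
    using 3 by (intro divide_right_mono) auto
  then show ?thesis unfolding a by (simp add: add_divide_distrib diff_divide_distrib)
qed (use assms in auto)

lemma pmf_bind_finite:
  assumes "finite A" "set_pmf p \<subseteq> A"
  shows "pmf (bind_pmf p f) y = (\<Sum>a\<in>A. pmf p a * pmf (f a) y)"
  unfolding pmf_bind using assms by (subst integral_measure_pmf[of A]) auto

text \<open>Integrability is given for each component only. The nonnegative integral of the mixture
  is computed first, and its finite value yields integrability and the expectation at once.\<close>

lemma expectation_bind_pmf_finite:
  fixes g :: "'b \<Rightarrow> real"
  assumes A: "finite A" "set_pmf p \<subseteq> A"
    and int: "\<And>a. a \<in> A \<Longrightarrow> integrable (measure_pmf (f a)) g"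
    and nn: "\<And>x. x \<in> set_pmf (bind_pmf p f) \<Longrightarrow> g x \<ge> 0"
  shows "measure_pmf.expectation (bind_pmf p f) g = (\<Sum>a\<in>A. pmf p a * measure_pmf.expectation (f a) g)"
proof -
  have fin: "finite (set_pmf p)" using A finite_subset by blast
  have nn': "AE x in measure_pmf (f a). g x \<ge> 0" if "a \<in> set_pmf p" for a
    by (rule AE_pmfI) (use that nn in auto)
  have "(\<integral>\<^sup>+x. ennreal (g x) \<partial>bind_pmf p f) = (\<Sum>a\<in>set_pmf p. (\<integral>\<^sup>+x. ennreal (g x) \<partial>f a) * ennreal (pmf p a))"
    by (simp add: nn_integral_measure_pmf_finite[OF fin])
  also have "\<dots> = (\<Sum>a\<in>set_pmf p. ennreal (pmf p a * measure_pmf.expectation (f a) g))"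
  proof (rule sum.cong[OF refl])
    fix a assume a: "a \<in> set_pmf p"
    have "(\<integral>\<^sup>+x. ennreal (g x) \<partial>f a) = ennreal (measure_pmf.expectation (f a) g)"
      by (rule nn_integral_eq_integral[OF int nn']) (use a A in auto)
    then show "(\<integral>\<^sup>+x. ennreal (g x) \<partial>f a) * ennreal (pmf p a) =
        ennreal (pmf p a * measure_pmf.expectation (f a) g)"
      using nn'[OF a] by (simp add: ennreal_mult integral_nonneg_AE mult.commute)
  qed
  also have "\<dots> = ennreal (\<Sum>a\<in>set_pmf p. pmf p a * measure_pmf.expectation (f a) g)"
    by (rule sum_ennreal) (auto intro!: mult_nonneg_nonneg integral_nonneg_AE nn')
  finally have "(\<integral>\<^sup>+x. ennreal (g x) \<partial>bind_pmf p f) = ennreal (\<Sum>a\<in>set_pmf p. pmf p a * measure_pmf.expectation (f a) g)" .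
  then have "measure_pmf.expectation (bind_pmf p f) g = (\<Sum>a\<in>set_pmf p. pmf p a * measure_pmf.expectation (f a) g)"
    using nn by (subst (asm) nn_integral_eq_integrable)
      (auto intro!: AE_pmfI sum_nonneg mult_nonneg_nonneg integral_nonneg_AE nn')
  also have "\<dots> = (\<Sum>a\<in>A. pmf p a * measure_pmf.expectation (f a) g)"
    by (rule sum.mono_neutral_left) (use A in \<open>auto simp: set_pmf_eq\<close>)
  finally show ?thesis .
qed

text \<open>Every mixture is pointwise at most \<open>K * u\<close>, where \<open>u\<close> is the
  uniform mixture. As \<open>u\<close> has finite entropy, \<open>xlogx_bound\<close> supplies the
  majorant for dominated convergence.\<close>

lemma tendsto_pmf_entropy_mixture:
  fixes f :: "'a \<Rightarrow> 'y::countable pmf" and P :: "nat \<Rightarrow> 'a pmf"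
  assumes A: "finite A" "A \<noteq> {}" and p: "set_pmf p \<subseteq> A" "\<And>k. set_pmf (P k) \<subseteq> A"
    and lim: "\<And>a. (\<lambda>k. pmf (P k) a) \<longlonglongrightarrow> pmf p a"
    and fin: "finite_entropy_pmf (bind_pmf (pmf_of_set A) f)"
  shows "(\<lambda>k. pmf_entropy (bind_pmf (P k) f)) \<longlonglongrightarrow> pmf_entropy (bind_pmf p f)"
proof -
  define K where "K = real (card A)"
  have K: "K \<ge> 1" using A by (simp add: K_def Suc_le_eq card_gt_0_iff)
  define u where "u = pmf (bind_pmf (pmf_of_set A) f)"
  have Ku: "K * u y = (\<Sum>a\<in>A. pmf (f a) y)" for y
    unfolding u_def using A by (subst pmf_bind_finite[of A]) (auto simp: K_def sum_divide_distrib[symmetric])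
  have dom: "pmf (bind_pmf q f) y \<le> K * u y" if "set_pmf q \<subseteq> A" for q y
    unfolding Ku pmf_bind_finite[OF A(1) that] by (intro sum_mono mult_left_le_one_le) (auto simp: pmf_le_1)
  have ent: "pmf_entropy (bind_pmf q f) = - (\<integral>y. pmf (bind_pmf q f) y * log 2 (pmf (bind_pmf q f) y) \<partial>count_space UNIV)" for q
    unfolding pmf_entropy_eq integral_pmf_count_space ..
  have iu: "integrable (count_space UNIV) (\<lambda>y. K * u y / ln 2 + K * \<bar>u y * log 2 (u y)\<bar>)"
  proof -
    have "integrable (measure_pmf (bind_pmf (pmf_of_set A) f)) (\<lambda>y. log 2 (u y))"
      using fin by (simp add: finite_entropy_pmf_iff u_def)
    then have "integrable (count_space UNIV) (\<lambda>y. u y * log 2 (u y))"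
      using integrable_density[of "\<lambda>y. log 2 (u y)" "count_space UNIV" u]
      by (simp add: measure_pmf_eq_density u_def)
    moreover have "integrable (count_space UNIV) u"
      unfolding u_def by (rule integrable_pmf)
    ultimately show ?thesis by auto
  qed
  have "(\<lambda>k. \<integral>y. pmf (bind_pmf (P k) f) y * log 2 (pmf (bind_pmf (P k) f) y) \<partial>count_space UNIV)
    \<longlonglongrightarrow> (\<integral>y. pmf (bind_pmf p f) y * log 2 (pmf (bind_pmf p f) y) \<partial>count_space UNIV)"
  proof (rule integral_dominated_convergence[OF _ _ iu])
    show "AE y in count_space UNIV. (\<lambda>k. pmf (bind_pmf (P k) f) y * log 2 (pmf (bind_pmf (P k) f) y))
       \<longlonglongrightarrow> pmf (bind_pmf p f) y * log 2 (pmf (bind_pmf p f) y)"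
    proof (rule AE_I2, rule tendsto_xlogx)
      fix y
      show "(\<lambda>k. pmf (bind_pmf (P k) f) y) \<longlonglongrightarrow> pmf (bind_pmf p f) y"
        unfolding pmf_bind_finite[OF A(1) p(1)] pmf_bind_finite[OF A(1) p(2)]
        by (intro tendsto_sum tendsto_mult lim tendsto_const)
    qed simp
    show "AE y in count_space UNIV. norm (pmf (bind_pmf (P k) f) y * log 2 (pmf (bind_pmf (P k) f) y))
       \<le> K * u y / ln 2 + K * \<bar>u y * log 2 (u y)\<bar>" for k
      unfolding real_norm_def
      by (intro AE_I2 xlogx_bound dom p K) (auto simp: pmf_le_1 u_def)
  qed auto
  then show ?thesis unfolding ent by (rule tendsto_minus)
qed

lemma joint_pmf_bind: "joint_pmf p W = bind_pmf p (\<lambda>a. map_pmf (Pair a) (sign_output W a))"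
  by (simp add: joint_pmf_eq map_pmf_def)

lemma pmf_joint_pmf: "pmf (joint_pmf p W) (a, v) = pmf p a * pmf (sign_output W a) v"
proof -
  have "pmf (map_pmf (Pair b) (sign_output W b)) (a, v) = indicator {a} b * pmf (sign_output W a) v" for b
  proof (cases "b = a")
    case True
    then show ?thesis using pmf_map_inj'[of "Pair a" "sign_output W a" v] by (simp add: inj_on_def)
  next
    case False
    then show ?thesis by (auto simp: pmf_eq_0_set_pmf)
  qed
  then show ?thesis
    unfolding joint_pmf_bind pmf_bind by (simp add: measure_pmf_single)
qed

text \<open>With a point mass as amplitude distribution, the sign-output marginal is the conditional
  law itself.\<close>

lemma finite_entropy_sign_output:
  fixes W :: "int \<Rightarrow> 'y::countable pmf"
  assumes "finite_entropy_pmf (joint_pmf (return_pmf a) W)"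
  shows "finite_entropy_pmf (sign_output W a)"
proof -
  have "map_pmf snd (joint_pmf (return_pmf a) W) = sign_output W a"
    by (simp add: joint_pmf_bind bind_return_pmf map_pmf_comp)
  then show ?thesis using finite_entropy_pmf_map[OF assms, of snd] by simp
qed

text \<open>Chain rule H(ASY) = H(A) + H(SY|A), in a form whose conditional part is visibly linear
  in \<open>p\<close> and hence continuous.\<close>

lemma pmf_entropy_joint_pmf:
  fixes W :: "int \<Rightarrow> 'y::countable pmf"
  assumes A: "finite A" "set_pmf p \<subseteq> A"
    and fin: "finite_entropy_pmf (joint_pmf p W)"
    and fin': "\<And>a. a \<in> A \<Longrightarrow> finite_entropy_pmf (sign_output W a)"
  shows "pmf_entropy (joint_pmf p W) = pmf_entropy p + (\<Sum>a\<in>A. pmf p a * pmf_entropy (sign_output W a))"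
proof -
  let ?J = "joint_pmf p W"
  \<comment> \<open>Conditional information of sign and output given the amplitude; it is
    nonnegative on the support, which allows taking expectations amplitude by amplitude.\<close>
  define g where "g z = - log 2 (pmf (sign_output W (fst z)) (snd z))" for z
  have fstJ: "map_pmf fst ?J = p"
    by (simp add: joint_pmf_bind map_bind_pmf map_pmf_comp map_pmf_const bind_return_pmf')
  have i1: "integrable (measure_pmf ?J) (\<lambda>z. log 2 (pmf ?J z))"
    using fin by (simp add: finite_entropy_pmf_iff)
  have i2: "integrable (measure_pmf ?J) (\<lambda>z. log 2 (pmf p (fst z)))"
    using finite_entropy_pmf_map[OF fin, of fst]
      integrable_map_pmf_eq[of fst ?J "\<lambda>a. log 2 (pmf p a)"] by (simp add: finite_entropy_pmf_iff fstJ)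
  have "pmf_entropy ?J = - measure_pmf.expectation ?J (\<lambda>z. log 2 (pmf ?J z))"
    by (rule pmf_entropy_eq)
  have split: "log 2 (pmf ?J z) = log 2 (pmf p (fst z)) - g z" if z: "z \<in> set_pmf ?J" for z
  proof -
    have "pmf ?J z > 0" using z by (simp add: pmf_positive)
    then have "pmf p (fst z) * pmf (sign_output W (fst z)) (snd z) > 0"
      using pmf_joint_pmf[of p W "fst z" "snd z"] by simp
    then have "pmf p (fst z) > 0" "pmf (sign_output W (fst z)) (snd z) > 0"
      by (auto simp: zero_less_mult_iff)
    then show ?thesis
      using pmf_joint_pmf[of p W "fst z" "snd z"] by (simp add: g_def log_mult_pos)
  qed
  have "measure_pmf.expectation ?J (\<lambda>z. log 2 (pmf p (fst z)) - log 2 (pmf ?J z)) = measure_pmf.expectation ?J g"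
    by (rule integral_cong_AE) (auto intro!: AE_pmfI simp: split)
  then have 1: "measure_pmf.expectation ?J g = pmf_entropy ?J - pmf_entropy p"
    using i1 i2 pmf_entropy_eq[of ?J] pmf_entropy_eq[of p] integral_map_pmf[of fst ?J "\<lambda>a. log 2 (pmf p a)"]
    by (simp add: fstJ)
  have "measure_pmf.expectation ?J g = (\<Sum>a\<in>A. pmf p a * measure_pmf.expectation (map_pmf (Pair a) (sign_output W a)) g)"
    unfolding joint_pmf_bind
  proof (rule expectation_bind_pmf_finite[OF A])
    show "integrable (measure_pmf (map_pmf (Pair a) (sign_output W a))) g" if "a \<in> A" for a
      using fin'[OF that] by (simp add: finite_entropy_pmf_iff g_def)
    show "g z \<ge> 0" if "z \<in> set_pmf (bind_pmf p (\<lambda>a. map_pmf (Pair a) (sign_output W a)))" for z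
    proof -
      have "snd z \<in> set_pmf (sign_output W (fst z))" using that by auto
      then have "pmf (sign_output W (fst z)) (snd z) > 0" by (rule pmf_positive)
      then show ?thesis by (simp add: g_def pmf_le_1)
    qed
  qed
  also have "\<dots> = (\<Sum>a\<in>A. pmf p a * pmf_entropy (sign_output W a))"
    by (simp add: g_def pmf_entropy_eq)
  finally show ?thesis using 1 by simp
qed

text \<open>I(SA;Y) = H(AS) + H(Y) - H(A) - H(SY|A): two entropies on finite alphabets, one entropy
  of a mixture, and one term linear in the amplitude distribution.\<close>

lemma tendsto_mutual_info_SA_Y:
  fixes W :: "int \<Rightarrow> 'y::countable pmf" and P :: "nat \<Rightarrow> int pmf"
  assumes A: "finite A" "A \<noteq> {}" and p: "set_pmf p \<subseteq> A" "\<And>k. set_pmf (P k) \<subseteq> A"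
    and fin: "\<And>q. set_pmf q \<subseteq> A \<Longrightarrow> finite_entropy_pmf (joint_pmf q W)"
    and lim: "\<And>a. (\<lambda>k. pmf (P k) a) \<longlonglongrightarrow> pmf p a"
  shows "(\<lambda>k. mutual_info_SA_Y (P k) W) \<longlonglongrightarrow> mutual_info_SA_Y p W"
proof -
  have AS: "map_pmf (\<lambda>(a, s, y). (a, s)) (joint_pmf q W) = pair_pmf q (pmf_of_set signs)" for q
    by (simp add: joint_pmf_def sign_output_def pair_pmf_def map_pmf_def bind_assoc_pmf bind_return_pmf)
  have Y: "map_pmf (\<lambda>(a, s, y). y) (joint_pmf q W) = bind_pmf q (\<lambda>a. map_pmf snd (sign_output W a))" for q
    by (simp add: joint_pmf_def sign_output_def map_pmf_def bind_assoc_pmf bind_return_pmf)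
  have fin': "finite_entropy_pmf (sign_output W a)" if "a \<in> A" for a
    by (rule finite_entropy_sign_output, rule fin) (use that in auto)
  have I: "mutual_info_SA_Y q W = pmf_entropy (pair_pmf q (pmf_of_set signs)) +
      pmf_entropy (bind_pmf q (\<lambda>a. map_pmf snd (sign_output W a))) -
      (pmf_entropy q + (\<Sum>a\<in>A. pmf q a * pmf_entropy (sign_output W a)))" if "set_pmf q \<subseteq> A" for q
    using pmf_entropy_joint_pmf[OF A(1) that fin[OF that] fin']
    unfolding mutual_info_SA_Y_entropy[OF fin[OF that]] AS Y by simp
  have signs: "finite signs" "signs \<noteq> {}" by (auto simp: signs_def)
  have "finite_entropy_pmf (bind_pmf (pmf_of_set A) (\<lambda>a. map_pmf snd (sign_output W a)))"
    unfolding Y[symmetric] by (intro finite_entropy_pmf_map fin) (use A in auto)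
  then show ?thesis
    unfolding I[OF p(1)] I[OF p(2)]
    by (intro tendsto_diff tendsto_add tendsto_sum tendsto_mult tendsto_const lim
        tendsto_pmf_entropy_finite[OF A(1) p lim] tendsto_pmf_entropy_mixture[OF A p lim]
        tendsto_pmf_entropy_finite[of "A \<times> signs"])
       (use A p signs in \<open>auto simp: pmf_pair intro!: tendsto_mult lim\<close>)
qed

section \<open>Sequential compactness of the distributions on a finite set\<close>

text \<open>Bolzano-Weierstrass one coordinate at a time; refining the subsequence preserves the
  limits already obtained.\<close>

lemma convergent_subsequence_finite:
  fixes f :: "nat \<Rightarrow> 'a \<Rightarrow> real"
  assumes "finite A" "\<And>k a. f k a \<in> {0..1}"
  shows "\<exists>r::nat \<Rightarrow> nat. strict_mono r \<and> (\<forall>a\<in>A. convergent (\<lambda>k. f (r k) a))"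
  using assms(1)
proof (induction A)
  case empty
  show ?case by (intro exI[of _ id]) (auto simp: strict_mono_def)
next
  case (insert x A)
  then obtain r :: "nat \<Rightarrow> nat" where r: "strict_mono r" "\<And>a. a \<in> A \<Longrightarrow> convergent (\<lambda>k. f (r k) a)" by blast
  obtain l r' where r': "strict_mono (r' :: nat \<Rightarrow> nat)" "((\<lambda>k. f (r k) x) \<circ> r') \<longlonglongrightarrow> l"
    using compact_Icc[of 0 "1::real", unfolded compact_def, rule_format, of "\<lambda>k. f (r k) x"] assms(2) by metis
  have "convergent (\<lambda>k. f ((r \<circ> r') k) a)" if "a \<in> insert x A" for a
  proof (cases "a = x")
    case True
    then show ?thesis using r'(2) by (auto simp: convergent_def o_def)
  next
    case False
    then have "convergent (\<lambda>k. f (r k) a)" using r(2) that by simp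
    from convergent_subseq_convergent[OF this r'(1)] show ?thesis by (simp add: o_def)
  qed
  then show ?case using strict_mono_o[OF r(1) r'(1)] by (intro exI[of _ "r \<circ> r'"]) blast
qed

text \<open>The pointwise limit is again a distribution because the total mass is a finite sum and
  passes to the limit.\<close>

lemma pmf_convergent_subsequence:
  fixes P :: "nat \<Rightarrow> 'a pmf"
  assumes A: "finite A" and P: "\<And>k. set_pmf (P k) \<subseteq> A"
  shows "\<exists>(r :: nat \<Rightarrow> nat) p. strict_mono r \<and> set_pmf p \<subseteq> A \<and> (\<forall>a. (\<lambda>k. pmf (P (r k)) a) \<longlonglongrightarrow> pmf p a)"
proof -
  obtain r :: "nat \<Rightarrow> nat" where r: "strict_mono r" "\<And>a. a \<in> A \<Longrightarrow> convergent (\<lambda>k. pmf (P (r k)) a)"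
    using convergent_subsequence_finite[OF A, of "\<lambda>k. pmf (P k)"] by (auto simp: pmf_le_1)
  define l where "l a = (if a \<in> A then lim (\<lambda>k. pmf (P (r k)) a) else 0)" for a
  have P0: "pmf (P k) a = 0" if "a \<notin> A" for k a
    using P[of k] that by (auto simp: pmf_eq_0_set_pmf)
  have l: "(\<lambda>k. pmf (P (r k)) a) \<longlonglongrightarrow> l a" for a
    using r(2) P0 by (cases "a \<in> A") (auto simp: l_def convergent_LIMSEQ_iff)
  have l0: "l a \<ge> 0" for a by (rule LIMSEQ_le_const[OF l]) auto
  have "(\<lambda>k. \<Sum>a\<in>A. pmf (P (r k)) a) \<longlonglongrightarrow> (\<Sum>a\<in>A. l a)" by (intro tendsto_sum l)
  moreover have "(\<Sum>a\<in>A. pmf (P (r k)) a) = 1" for k by (rule sum_pmf_eq_1[OF A P])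
  ultimately have sum1: "(\<Sum>a\<in>A. l a) = 1" by (simp add: LIMSEQ_const_iff)
  have "(\<integral>\<^sup>+a. ennreal (l a) \<partial>count_space UNIV) = (\<Sum>a\<in>A. ennreal (l a))"
    by (rule nn_integral_count_space'[OF A]) (auto simp: l_def)
  also have "\<dots> = 1" by (simp add: sum_ennreal l0 sum1)
  finally have one: "(\<integral>\<^sup>+a. ennreal (l a) \<partial>count_space UNIV) = 1" .
  have "pmf (embed_pmf l) = l" by (rule ext, rule pmf_embed_pmf) (use l0 one in auto)
  moreover from this have "set_pmf (embed_pmf l) \<subseteq> A" by (auto simp: set_pmf_eq l_def split: if_splits)
  ultimately show ?thesis using r(1) l by (intro exI[of _ r] exI[of _ "embed_pmf l"]) auto
qed

section \<open>Boundedness of entropy and nonnegativity of mutual information\<close>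

lemma pmf_entropy_finite_le:
  fixes p :: "'a::countable pmf"
  assumes "finite A" "set_pmf p \<subseteq> A"
  shows "pmf_entropy p \<le> card A / ln 2"
proof -
  have "pmf_entropy p = (\<Sum>a\<in>A. - (pmf p a * log 2 (pmf p a)))"
    unfolding pmf_entropy_finite[OF assms] by (simp add: sum_negf)
  also have "\<dots> \<le> (\<Sum>a\<in>A. 1 / ln 2)"
  proof (rule sum_mono)
    fix a
    show "- (pmf p a * log 2 (pmf p a)) \<le> 1 / ln 2"
      using xlogx_bound[of "pmf p a" 1 1] by (auto simp: pmf_le_1)
  qed
  finally show ?thesis by simp
qed

text \<open>Apply ln x \<le> x - 1 to the ratio of the masses of \<open>R\<close> and
  \<open>P\<close>, whose mean under \<open>P\<close> is at most 1.\<close>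

lemma Gibbs_inequality_pmf:
  assumes intP: "integrable (measure_pmf P) (\<lambda>z. log 2 (pmf P z))"
    and intR: "integrable (measure_pmf P) (\<lambda>z. log 2 (pmf R z))"
    and ac: "set_pmf P \<subseteq> set_pmf R"
  shows "measure_pmf.expectation P (\<lambda>z. log 2 (pmf R z)) \<le> measure_pmf.expectation P (\<lambda>z. log 2 (pmf P z))"
proof -
  let ?h = "\<lambda>z. pmf R z / pmf P z"
  have "(\<integral>\<^sup>+z. ennreal (?h z) \<partial>P) = (\<integral>\<^sup>+z. ennreal (pmf P z) * ennreal (?h z) \<partial>count_space UNIV)"
    by (rule nn_integral_measure_pmf)
  also have "\<dots> \<le> (\<integral>\<^sup>+z. ennreal (pmf R z) \<partial>count_space UNIV)"
    by (intro nn_integral_mono) (auto simp: ennreal_mult[symmetric] intro!: ennreal_leI)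
  also have "\<dots> = 1" by (simp add: nn_integral_pmf)
  finally have le1: "(\<integral>\<^sup>+z. ennreal (?h z) \<partial>P) \<le> 1" .
  then have inth: "integrable (measure_pmf P) ?h"
    by (intro integrableI_nonneg) (auto intro: le_less_trans)
  have "ennreal (measure_pmf.expectation P ?h) \<le> ennreal 1"
    using le1 nn_integral_eq_integral[OF inth] by simp
  then have Eh: "measure_pmf.expectation P ?h \<le> 1" by (subst (asm) ennreal_le_iff) auto
  have "measure_pmf.expectation P (\<lambda>z. log 2 (pmf R z) - log 2 (pmf P z)) \<le>
      measure_pmf.expectation P (\<lambda>z. (?h z - 1) / ln 2)"
  proof (rule integral_mono_AE)
    show "AE z in measure_pmf P. log 2 (pmf R z) - log 2 (pmf P z) \<le> (?h z - 1) / ln 2"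
    proof (rule AE_pmfI)
      fix z assume "z \<in> set_pmf P"
      then have pos: "pmf P z > 0" "pmf R z > 0" using ac by (auto intro!: pmf_positive)
      then have "ln (?h z) / ln 2 \<le> (?h z - 1) / ln 2"
        by (intro divide_right_mono ln_le_minus_one) auto
      then show "log 2 (pmf R z) - log 2 (pmf P z) \<le> (?h z - 1) / ln 2"
        using pos by (simp add: log_def ln_div diff_divide_distrib)
    qed
  qed (use intP intR inth in auto)
  also have "\<dots> = (measure_pmf.expectation P ?h - 1) / ln 2" using inth by simp
  also have "\<dots> \<le> 0" using Eh by (simp add: divide_nonpos_pos)
  finally show ?thesis using intP intR by simp
qed

text \<open>Gibbs' inequality for the joint law against \<open>indep_joint_pmf\<close>, whose masses
  are the products of the marginals. It makes point masses feasible for the maximisation.\<close>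

lemma mutual_info_SA_Y_nonneg:
  fixes W :: "int \<Rightarrow> 'y::countable pmf"
  assumes fin: "finite_entropy_pmf (joint_pmf p W)"
  shows "0 \<le> mutual_info_SA_Y p W"
proof -
  let ?J = "joint_pmf p W" and ?R = "indep_joint_pmf p W"
  let ?as = "\<lambda>(a, s, y). (a, s)" and ?y = "\<lambda>(a, s, y). y"
  have R: "pmf ?R z = pmf (map_pmf ?as ?J) (?as z) * pmf (map_pmf ?y ?J) (?y z)" for z
    by (cases z) (simp add: pmf_indep_joint_pmf)
  have pos: "pmf (map_pmf ?as ?J) (?as z) > 0" "pmf (map_pmf ?y ?J) (?y z) > 0" if "z \<in> set_pmf ?J" for z
    using imageI[OF that, of ?as] imageI[OF that, of ?y] unfolding set_map_pmf[symmetric]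
    by (auto intro: pmf_positive simp del: set_map_pmf)
  have i1: "integrable (measure_pmf ?J) (\<lambda>z. log 2 (pmf ?J z))"
    using fin by (simp add: finite_entropy_pmf_iff)
  have i2: "integrable (measure_pmf ?J) (\<lambda>z. log 2 (pmf (map_pmf ?as ?J) (?as z)))"
    using finite_entropy_pmf_map[OF fin, of ?as] by (simp add: finite_entropy_pmf_iff)
  have i3: "integrable (measure_pmf ?J) (\<lambda>z. log 2 (pmf (map_pmf ?y ?J) (?y z)))"
    using finite_entropy_pmf_map[OF fin, of ?y] by (simp add: finite_entropy_pmf_iff)
  have eq: "AE z in measure_pmf ?J. log 2 (pmf ?R z) =
      log 2 (pmf (map_pmf ?as ?J) (?as z)) + log 2 (pmf (map_pmf ?y ?J) (?y z))"
    by (rule AE_pmfI) (use pos R in \<open>simp add: log_mult_pos\<close>)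
  have iR: "integrable (measure_pmf ?J) (\<lambda>z. log 2 (pmf ?R z))"
    by (subst integrable_cong_AE[OF _ _ eq]) (use i2 i3 in auto)
  have "set_pmf ?J \<subseteq> set_pmf ?R"
  proof
    fix z assume "z \<in> set_pmf ?J"
    from pos[OF this] have "pmf ?R z > 0" unfolding R by (rule mult_pos_pos)
    then show "z \<in> set_pmf ?R" by (simp add: pmf_positive_iff)
  qed
  from Gibbs_inequality_pmf[OF i1 iR this]
  have "measure_pmf.expectation ?J (\<lambda>z. log 2 (pmf ?R z)) \<le> measure_pmf.expectation ?J (\<lambda>z. log 2 (pmf ?J z))" .
  also have "measure_pmf.expectation ?J (\<lambda>z. log 2 (pmf ?R z)) =
      measure_pmf.expectation ?J (\<lambda>z. log 2 (pmf (map_pmf ?as ?J) (?as z)) + log 2 (pmf (map_pmf ?y ?J) (?y z)))"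
    by (rule integral_cong_AE[OF _ _ eq]) auto
  also have "\<dots> = - pmf_entropy (map_pmf ?as ?J) - pmf_entropy (map_pmf ?y ?J)"
    unfolding pmf_entropy_eq using i2 i3 by simp
  finally show ?thesis
    unfolding mutual_info_SA_Y_entropy[OF fin] pmf_entropy_eq[of ?J] by simp
qed

section \<open>The maximum is attained\<close>

text \<open>A maximising sequence has a convergent subsequence; by continuity of both sides the
  constraint survives in the limit, and the limit's entropy is the supremum.\<close>

lemma exists_arg_max_entropy:
  fixes W :: "int \<Rightarrow> 'y::countable pmf"
  assumes A: "finite A" "A \<noteq> {}"
    and fin: "\<And>q. set_pmf q \<subseteq> A \<Longrightarrow> finite_entropy_pmf (joint_pmf q W)"
    and ne: "\<exists>p. set_pmf p \<subseteq> A \<and> pmf_entropy p \<le> mutual_info_SA_Y p W"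
  shows "\<exists>p. is_arg_max pmf_entropy (\<lambda>p. set_pmf p \<subseteq> A \<and> pmf_entropy p \<le> mutual_info_SA_Y p W) p"
proof -
  define F where "F = {p. set_pmf p \<subseteq> A \<and> pmf_entropy p \<le> mutual_info_SA_Y p W}"
  define h where "h = Sup (pmf_entropy ` F)"
  have bdd: "bdd_above (pmf_entropy ` F)"
    by (rule bdd_aboveI2[of _ _ "card A / ln 2"]) (auto simp: F_def intro: pmf_entropy_finite_le A)
  have "\<exists>p\<in>F. h - 1 / real (Suc k) < pmf_entropy p" for k
    using less_cSup_iff[OF _ bdd, of "h - 1 / real (Suc k)"] ne by (auto simp: h_def F_def)
  then obtain P where P: "\<And>k. P k \<in> F" "\<And>k. h - 1 / real (Suc k) < pmf_entropy (P k)" by metis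
  have PA: "\<And>k. set_pmf (P k) \<subseteq> A" using P(1) by (auto simp: F_def)
  obtain r :: "nat \<Rightarrow> nat" and p where r: "strict_mono r" and p: "set_pmf p \<subseteq> A"
    and lim: "\<And>a. (\<lambda>k. pmf (P (r k)) a) \<longlonglongrightarrow> pmf p a"
    using pmf_convergent_subsequence[of A P, OF A(1) PA] by blast
  have H: "(\<lambda>k. pmf_entropy (P (r k))) \<longlonglongrightarrow> pmf_entropy p"
    by (rule tendsto_pmf_entropy_finite[OF A(1) p PA lim])
  have I: "(\<lambda>k. mutual_info_SA_Y (P (r k)) W) \<longlonglongrightarrow> mutual_info_SA_Y p W"
    by (rule tendsto_mutual_info_SA_Y[OF A p PA fin lim])
  have "pmf_entropy p \<le> mutual_info_SA_Y p W"
    by (rule LIMSEQ_le[OF H I]) (use P(1) in \<open>auto simp: F_def\<close>)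
  then have pF: "p \<in> F" using p by (simp add: F_def)
  have "(\<lambda>k. h - 1 / real (Suc k)) \<longlonglongrightarrow> h - 0"
    by (intro tendsto_diff tendsto_const LIMSEQ_Suc[OF lim_1_over_n])
  then have "(\<lambda>k. h - 1 / real (Suc (r k))) \<longlonglongrightarrow> h"
    using LIMSEQ_subseq_LIMSEQ[OF _ r] by (fastforce simp: o_def)
  then have "h \<le> pmf_entropy p"
    by (rule LIMSEQ_le[OF _ H]) (use P(2) less_imp_le in blast)
  moreover have "pmf_entropy q \<le> h" if "q \<in> F" for q
    unfolding h_def by (rule cSup_upper[OF _ bdd]) (use that in auto)
  ultimately have "\<not> (\<exists>q. q \<in> F \<and> pmf_entropy q > pmf_entropy p)" by (meson not_le order_trans)
  then show ?thesis using pF unfolding is_arg_max_def F_def by auto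
qed

theorem theorem1:
  fixes m M :: nat and W :: "int \<Rightarrow> 'y::countable pmf"
  assumes "m \<ge> 1" and "M = 2 ^ (m + 1)"
    and "\<And>p. set_pmf p \<subseteq> amplitudes M \<Longrightarrow> finite_entropy_pmf (joint_pmf p W)"
  shows "\<exists>p. is_arg_max pmf_entropy
               (\<lambda>p. set_pmf p \<subseteq> amplitudes M \<and> pmf_entropy p \<le> mutual_info_SA_Y p W) p \<and>
             achievable_smd M W (pmf_entropy p)"
proof -
  have ne: "amplitudes M \<noteq> {}"
    using assms(1,2) by (auto simp: amplitudes_def intro!: exI[of _ 0])
  then obtain a where a: "a \<in> amplitudes M" by blast
  \<comment> \<open>A point mass has zero entropy and so satisfies the constraint: the set over
    which the maximum is taken is nonempty.\<close>
  have "pmf_entropy (return_pmf a) = 0"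
    using pmf_entropy_finite[of "{a}" "return_pmf a"] by simp
  moreover have "mutual_info_SA_Y (return_pmf a) W \<ge> 0"
    using a by (intro mutual_info_SA_Y_nonneg assms(3)) auto
  ultimately have "\<exists>p. set_pmf p \<subseteq> amplitudes M \<and> pmf_entropy p \<le> mutual_info_SA_Y p W"
    using a by (intro exI[of _ "return_pmf a"]) auto
  then obtain p where p: "is_arg_max pmf_entropy
      (\<lambda>p. set_pmf p \<subseteq> amplitudes M \<and> pmf_entropy p \<le> mutual_info_SA_Y p W) p"
    using exists_arg_max_entropy[OF finite_amplitudes ne assms(3)] by blast
  then have "set_pmf p \<subseteq> amplitudes M" "pmf_entropy p \<le> mutual_info_SA_Y p W"
    by (auto simp: is_arg_max_def)
  then have "achievable_smd M W (pmf_entropy p)"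
    by (intro achievable_smd_entropy assms(3))
  with p show ?thesis by blast
qed

end
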